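(* Let $p_j$ denote the $j$-th prime. Let $d \in [p_j, p_{j+1}]$ be an integer and let $\alpha \in (0, 1/6)$. Suppose that $\frac{\log(p_j)}{\log(p_{j+1})} > 6\alpha$. Then for every $\varepsilon \in (0,1)$ there exist infinitely many positive integers $m$ and $(d+1)$-regular graphs $G_m$ with $m$ vertices satisfying the following conditions for each such $m$: (1) $\mathrm{girth}(G_m) \geq 2\alpha \log_{2d-1}(m) \geq 2\alpha \log_d(m)\cdot\left(1 - \frac{\log 2}{\log(2d-1)}\right)$; (2) there exist $\lfloor \alpha \log_d(m) \rfloor$ eigenvalues $\lambda_1, \lambda_2, \ldots, \lambda_{\lfloor \alpha \log_d(m) \rfloor}$ of the adjacency matrix $A(G_m)$ such that each has a corresponding $(k,\varepsilon)$-localized eigenvector with $k = O(m^\alpha)$ as $m \to \infty$. In particular, the same conclusion (for every $\varepsilon\in(0,1)$, the existence of infinitely many $m$ and $(d+1)$-regular graphs $G_m$ on $m$ vertices satisfying (1) and (2)) holds for every integer $d \geq p_{10} = 29$ and every $\alpha \in \left(0, \frac{\log(p_{10})}{6\log(p_{11})}\right)$, where $\frac{\log(p_{10})}{6\log(p_{11})} \approx 0.163$.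
   Context: Graphs are finite and simple. For a graph $G$, $\mathrm{girth}(G)$ is the length of a shortest cycle of $G$. The adjacency matrix $A(G)$ is the square $0$-$1$ matrix indexed by the vertices of $G$ whose $(u,v)$-entry is $1$ if and only if $u$ and $v$ are adjacent. All eigenvectors are normalized with respect to the $\ell_2$ norm. An eigenvector $\mathbf{v} = (v_x)_{x\in V(G)}$ of $A(G)$ is called $(k,\varepsilon)$-localized if there exists $S \subset V(G)$ with $|S| = k$ and $\|\mathbf{v}_S\|_2^2 := \sum_{x\in S} v_x^2 \geq \varepsilon$. The asymptotic notation $k=O(m^\alpha)$ refers to $m\to\infty$ along the infinite family of $m$, with $d$, $\alpha$, $\varepsilon$ fixed. The primes are indexed so that $p_1=2$, $p_{10}=29$, $p_{11}=31$. *)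

theory Defs
  imports
    Complex_Main
    "HOL-Library.Infinite_Set"
    "HOL-Library.Extended_Real"
    "HOL-Library.Landau_Symbols"
    "HOL-Computational_Algebra.Primes"
    "Graph_Theory.Pair_Digraph"
    "Jordan_Normal_Form.Char_Poly"
begin

text \<open>
  The enumeration of primes is 1-based, so that \<open>nth_prime 1 = 2\<close>;
  the library function \<^const>\<open>enumerate\<close> counts from 0.
\<close>

definition nth_prime :: "nat \<Rightarrow> nat" where
  "nth_prime j = enumerate {p. prime p} (j - 1)"

text \<open>
  A finite simple graph is a \<^locale>\<open>pair_graph\<close>, in which an undirected edge is a
  symmetric pair of arcs; hence the degree of a vertex is its out-degree.
\<close>

definition regular :: "nat \<Rightarrow> 'a pair_pre_digraph \<Rightarrow> bool" where
  "regular r G \<longleftrightarrow> (\<forall>v\<in>pverts G. out_degree (with_proj G) v = r)"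

text \<open>
  The library's notion of a cycle in a symmetric digraph admits the back-and-forth walk
  along a single edge, which is not a cycle of the undirected graph. It is the only one to be
  excluded, since there are no loops. The girth of a forest is \<open>\<infinity>\<close>.
\<close>

definition girth :: "'a pair_pre_digraph \<Rightarrow> enat" where
  "girth G = (INF p \<in> {p. pre_digraph.cycle (with_proj G) p \<and> 3 \<le> length p}. enat (length p))"

text \<open>
  Matrices are indexed by initial segments of the natural numbers, so the adjacency matrix
  is meant for graphs whose vertex set is \<open>{0..<n}\<close>.
\<close>

definition adjacency_mat :: "nat pair_pre_digraph \<Rightarrow> real mat" where
  "adjacency_mat G = mat (card (pverts G)) (card (pverts G))
     (\<lambda>(u, v). if (u, v) \<in> parcs G then 1 else 0)"

definition normalized_eigenvector :: "real mat \<Rightarrow> real vec \<Rightarrow> real \<Rightarrow> bool" where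
  "normalized_eigenvector A v \<mu> \<longleftrightarrow> eigenvector A v \<mu> \<and> v \<bullet> v = 1"

definition localized :: "nat \<Rightarrow> real \<Rightarrow> real vec \<Rightarrow> bool" where
  "localized k \<epsilon> v \<longleftrightarrow> (\<exists>S \<subseteq> {0..<dim_vec v}. card S = k \<and> (\<Sum>x\<in>S. (v $ x)\<^sup>2) \<ge> \<epsilon>)"

text \<open>
  The set \<open>M\<close> is the infinite family of orders \<open>m\<close>, and \<open>k = O(m\<^sup>\<alpha>)\<close> is
  asserted as \<open>m\<close> tends to infinity within \<open>M\<close>. The injectivity condition says that the
  eigenvalues \<open>\<mu> m 1, \<mu> m 2, \<dots>\<close> of the graph \<open>G m\<close> are pairwise distinct.
\<close>

definition high_girth_localized :: "nat \<Rightarrow> real \<Rightarrow> real \<Rightarrow> bool" where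
  "high_girth_localized d \<alpha> \<epsilon> \<longleftrightarrow>
    (\<exists>(M :: nat set) (G :: nat \<Rightarrow> nat pair_pre_digraph) (k :: nat \<Rightarrow> nat) (\<mu> :: nat \<Rightarrow> nat \<Rightarrow> real).
       infinite M \<and>
       (\<lambda>m. real (k m)) \<in> O[inf at_top (principal M)](\<lambda>m. real m powr \<alpha>) \<and>
       (\<forall>m\<in>M.
          0 < m \<and> pair_graph (G m) \<and> pverts (G m) = {0..<m} \<and> regular (d + 1) (G m) \<and>
          ereal_of_enat (girth (G m)) \<ge> ereal (2 * \<alpha> * log (2 * real d - 1) (real m)) \<and>
          2 * \<alpha> * log (2 * real d - 1) (real m)
            \<ge> 2 * \<alpha> * log (real d) (real m) * (1 - ln 2 / ln (2 * real d - 1)) \<and>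
          inj_on (\<mu> m) {1..nat \<lfloor>\<alpha> * log (real d) (real m)\<rfloor>} \<and>
          (\<forall>i\<in>{1..nat \<lfloor>\<alpha> * log (real d) (real m)\<rfloor>}.
             \<exists>v. normalized_eigenvector (adjacency_mat (G m)) v (\<mu> m i) \<and> localized (k m) \<epsilon> v)))"

end

theory Submission
  imports Defs "HOL-Real_Asymp.Real_Asymp"
begin

text \<open>
The theorem follows from \<open>high_girth_localized_below_sixth\<close>, which has the conclusion for every
\<open>d \<ge> 2\<close> and every positive \<open>\<alpha> < 1 / 6\<close>: primes are at least 2, and the second constant is below \<open>1 / 6\<close>.

Localized eigenvectors are obtained by cancellation. Take \<open>N\<close> positive and \<open>N\<close> negative copies of a path
with \<open>L\<close> vertices. For \<open>t = pi * j / (L + 1)\<close> the function \<open>sin (t * (i + 1))\<close>, for \<open>i = 0, \<dots>, L - 1\<close>,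
satisfies the eigenvalue equation on the path with eigenvalue \<open>2 * cos t\<close>, and \<open>j = 1, \<dots>, L\<close> give distinct
eigenvalues. The neighbours that the vertices of the paths miss are supplied by links: each link is
joined to one vertex of a positive path and to one vertex, in the same position, of a negative path.
With the sine wave on the positive and its negative on the negative paths, the values at each link
cancel. So, whatever else is attached to the links, extension by zero gives an eigenvector that
lives on the \<open>2 * N * L\<close> vertices of the paths, for each of the \<open>L\<close> eigenvalues.

Two choices remain: which negative path a link is joined to, and how the links and a large number
of filler vertices are completed to a regular graph. Both are made by the switching argument of
Erdos and Sachs (\<open>bipartite_completion\<close>), which preserves girth \<open>g\<close> as soon as balls of radius
\<open>g\<close> are small compared with the number of candidates. For the links this is the crucial point. Passing from one path to
another takes two steps, and a weighted count of walks that never turn back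
(\<open>card_ball_le_weighted\<close>, \<open>card_ball_linked\<close>) bounds the balls by about \<open>\<theta> ^ g\<close> for some \<open>\<theta>\<close>
with \<open>\<theta>\<^sup>2 < 2 * d - 1\<close>. For \<open>g\<close> near \<open>2 * \<alpha> * log (2 * d - 1) m\<close> this is a power of \<open>m\<close> with an exponent
smaller than \<open>\<alpha>\<close>. So \<open>N\<close> can be taken of that size, and the support \<open>2 * N * L\<close> is still
\<open>O(m powr \<alpha>)\<close> although \<open>L\<close> grows like \<open>log d m\<close>. For the completion the degree bound suffices: balls
have size about \<open>d ^ g\<close>, far less than \<open>m\<close>. The parameters are fixed in
\<open>parameters_exist\<close>.
\<close>

section \<open>Girth under insertion and switching of edges\<close>

text \<open>
Two vertices are apart if they have distance at least \<open>g - 1\<close>: exactly then a new edge between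
them closes no cycle shorter than \<open>g\<close>.
\<close>

definition apart :: "nat \<Rightarrow> 'a rel \<Rightarrow> 'a \<Rightarrow> 'a \<Rightarrow> bool" where
  "apart g E x y \<longleftrightarrow> (\<forall>n. n + 1 < g \<longrightarrow> (x, y) \<notin> E ^^ n)"

text \<open>
A short cycle through an edge is a short walk between its ends that avoids the edge. Saying it
with powers of a relation keeps the switching arguments free of simple paths; \<open>girth_ge\<close> recovers
the bound on lengths of cycles.
\<close>

definition girth_at_least :: "nat \<Rightarrow> 'a rel \<Rightarrow> bool" where
  "girth_at_least g E \<longleftrightarrow> (\<forall>(u, v)\<in>E. apart g (E - {(u, v), (v, u)}) u v)"

lemma sym_relpow_swap:
  assumes "sym E" "(x, y) \<in> E ^^ n" shows "(y, x) \<in> E ^^ n"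
  using assms(2)
proof (induction n arbitrary: y)
  case (Suc n)
  then obtain z where "(x, z) \<in> E ^^ n" "(z, y) \<in> E" by auto
  with Suc.IH assms(1) show ?case by (meson relpow_Suc_I2 symD)
qed auto

lemma apart_sym: "sym E \<Longrightarrow> apart g E x y \<Longrightarrow> apart g E y x"
  unfolding apart_def by (blast intro: sym_relpow_swap)

lemma relpow_subset_mono:
  fixes E F :: "'a rel"
  assumes "E \<subseteq> F" "(x, y) \<in> E ^^ n" shows "(x, y) \<in> F ^^ n"
  using assms(2)
proof (induction n arbitrary: y)
  case (Suc n)
  then show ?case using assms(1) by (meson relpow_Suc_E relpow_Suc_I subsetD)
qed auto

lemma apart_subset: "apart g F x y \<Longrightarrow> E \<subseteq> F \<Longrightarrow> apart g E x y"
  unfolding apart_def by (blast dest: relpow_subset_mono)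

lemma girth_at_least_subset:
  assumes "girth_at_least g F" "E \<subseteq> F" shows "girth_at_least g E"
  unfolding girth_at_least_def
proof clarify
  fix u v assume "(u, v) \<in> E"
  then show "apart g (E - {(u, v), (v, u)}) u v"
    using assms apart_subset[of g "F - {(u, v), (v, u)}" u v "E - {(u, v), (v, u)}"]
    unfolding girth_at_least_def by blast
qed

text \<open>
Cut the walk at its first and at its last passage through the new edge. If these passages have the
same direction, the two outer pieces remain; if not, the outer pieces meet in the same end of the
edge and form a walk of the old graph.
\<close>

lemma walk_through_new_edge:
  assumes "(u, v) \<in> (E \<union> {(x, y), (y, x)}) ^^ n"
  shows "(\<exists>k\<le>n. (u, v) \<in> E ^^ k) \<or>
    (\<exists>a b. a + b + 1 \<le> n \<and> ((u, x) \<in> E ^^ a \<and> (y, v) \<in> E ^^ b \<or> (u, y) \<in> E ^^ a \<and> (x, v) \<in> E ^^ b))"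
  using assms
proof (induction n arbitrary: v)
  case 0
  then show ?case by auto
next
  case (Suc n)
  then obtain w where w: "(u, w) \<in> (E \<union> {(x, y), (y, x)}) ^^ n" "(w, v) \<in> E \<union> {(x, y), (y, x)}"
    by auto
  consider (old) "(w, v) \<in> E" | (xy) "w = x" "v = y" | (yx) "w = y" "v = x" using w(2) by blast
  then show ?case
  proof cases
    case old
    from Suc.IH[OF w(1)] show ?thesis
    proof (elim disjE exE conjE)
      fix k assume "k \<le> n" "(u, w) \<in> E ^^ k"
      then have "Suc k \<le> Suc n" "(u, v) \<in> E ^^ Suc k" using old by auto
      then show ?thesis by blast
    next
      fix a b assume "a + b + 1 \<le> n" "(u, x) \<in> E ^^ a" "(y, w) \<in> E ^^ b"
      then have "a + Suc b + 1 \<le> Suc n" "(u, x) \<in> E ^^ a" "(y, v) \<in> E ^^ Suc b" using old by auto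
      then show ?thesis by blast
    next
      fix a b assume "a + b + 1 \<le> n" "(u, y) \<in> E ^^ a" "(x, w) \<in> E ^^ b"
      then have "a + Suc b + 1 \<le> Suc n" "(u, y) \<in> E ^^ a" "(x, v) \<in> E ^^ Suc b" using old by auto
      then show ?thesis by blast
    qed
  next
    case xy
    from Suc.IH[OF w(1)] show ?thesis
    proof (elim disjE exE conjE)
      fix k assume "k \<le> n" "(u, w) \<in> E ^^ k"
      then have "k + 0 + 1 \<le> Suc n" "(u, x) \<in> E ^^ k" "(y, v) \<in> E ^^ 0" using xy by auto
      then show ?thesis by blast
    next
      fix a b assume "a + b + 1 \<le> n" "(u, x) \<in> E ^^ a" "(y, w) \<in> E ^^ b"
      then have "a + 0 + 1 \<le> Suc n" "(u, x) \<in> E ^^ a" "(y, v) \<in> E ^^ 0" using xy by auto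
      then show ?thesis by blast
    next
      fix a b assume "a + b + 1 \<le> n" "(u, y) \<in> E ^^ a" "(x, w) \<in> E ^^ b"
      then have "a \<le> Suc n" "(u, v) \<in> E ^^ a" using xy by auto
      then show ?thesis by blast
    qed
  next
    case yx
    from Suc.IH[OF w(1)] show ?thesis
    proof (elim disjE exE conjE)
      fix k assume "k \<le> n" "(u, w) \<in> E ^^ k"
      then have "k + 0 + 1 \<le> Suc n" "(u, y) \<in> E ^^ k" "(x, v) \<in> E ^^ 0" using yx by auto
      then show ?thesis by blast
    next
      fix a b assume "a + b + 1 \<le> n" "(u, x) \<in> E ^^ a" "(y, w) \<in> E ^^ b"
      then have "a \<le> Suc n" "(u, v) \<in> E ^^ a" using yx by auto
      then show ?thesis by blast
    next
      fix a b assume "a + b + 1 \<le> n" "(u, y) \<in> E ^^ a" "(x, w) \<in> E ^^ b"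
      then have "a + 0 + 1 \<le> Suc n" "(u, y) \<in> E ^^ a" "(x, v) \<in> E ^^ 0" using yx by auto
      then show ?thesis by blast
    qed
  qed
qed

lemma relpow_compose:
  fixes E :: "'a rel"
  shows "(x, y) \<in> E ^^ a \<Longrightarrow> (y, z) \<in> E ^^ b \<Longrightarrow> (x, z) \<in> E ^^ (a + b)"
  by (auto simp: relpow_add)

text \<open>
A walk that closes a short cycle through an old edge \<open>uv\<close> and uses the new edge \<open>xy\<close> turns into a
walk from \<open>x\<close> to \<open>y\<close> when the new edge is replaced by \<open>uv\<close>; that walk is short and contradicts
the distance of \<open>x\<close> and \<open>y\<close>.
\<close>

lemma girth_at_least_add_edge:
  assumes "sym E" "girth_at_least g E" "apart g E x y"
  shows "girth_at_least g (E \<union> {(x, y), (y, x)})"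
proof -
  let ?F = "E \<union> {(x, y), (y, x)}"
  have ap: "apart g E x y" "apart g E y x" using assms apart_sym by auto
  have "(u, v) \<notin> (?F - {(u, v), (v, u)}) ^^ n" if uv: "(u, v) \<in> ?F" and n: "n + 1 < g" for u v n
  proof
    assume walk: "(u, v) \<in> (?F - {(u, v), (v, u)}) ^^ n"
    show False
    proof (cases "(u, v) \<in> {(x, y), (y, x)}")
      case True
      then have "(u, v) \<in> E ^^ n" using walk by (auto elim: relpow_subset_mono[rotated])
      with True ap n show False unfolding apart_def by auto
    next
      case False
      then have uvE: "(u, v) \<in> E" "(v, u) \<in> E" using uv assms(1) by (auto dest: symD)
      let ?H = "E - {(u, v), (v, u)}"
      have "sym ?H" using assms(1) by (auto simp: sym_def)
      have sub: "?F - {(u, v), (v, u)} \<subseteq> ?H \<union> {(x, y), (y, x)}" by auto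
      have inE: "\<And>p q k. (p, q) \<in> ?H ^^ k \<Longrightarrow> (p, q) \<in> E ^^ k"
        by (erule relpow_subset_mono[rotated]) auto
      have rev: "\<And>p q k. (p, q) \<in> ?H ^^ k \<Longrightarrow> (q, p) \<in> E ^^ k"
        using \<open>sym ?H\<close> sym_relpow_swap inE by metis
      have vu: "(u, v) \<in> E ^^ 1" "(v, u) \<in> E ^^ 1" using uvE by auto
      from walk_through_new_edge[OF relpow_subset_mono[OF sub walk]]
      show False
      proof (elim disjE exE conjE)
        fix k assume "k \<le> n" "(u, v) \<in> ?H ^^ k"
        with assms(2) uvE n show False unfolding girth_at_least_def apart_def by fastforce
      next
        fix a b assume ab: "a + b + 1 \<le> n" "(u, x) \<in> ?H ^^ a" "(y, v) \<in> ?H ^^ b"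
        then have "(x, y) \<in> E ^^ (a + 1 + b)"
          using rev relpow_compose vu by metis
        moreover have "a + 1 + b + 1 < g" using ab(1) n by linarith
        ultimately show False using ap unfolding apart_def by blast
      next
        fix a b assume ab: "a + b + 1 \<le> n" "(u, y) \<in> ?H ^^ a" "(x, v) \<in> ?H ^^ b"
        then have "(y, x) \<in> E ^^ (a + 1 + b)"
          using rev relpow_compose vu by metis
        moreover have "a + 1 + b + 1 < g" using ab(1) n by linarith
        ultimately show False using ap unfolding apart_def by blast
      qed
    qed
  qed
  then show ?thesis unfolding girth_at_least_def apart_def by blast
qed

text \<open>
The switch of Erdos and Sachs replaces an edge \<open>uv\<close> by \<open>xv\<close> and \<open>uy\<close>. The two new edges cannot share
a short cycle: such a cycle contains a walk from \<open>u\<close> to \<open>x\<close>, which \<open>uv\<close> extends to a walk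
from \<open>v\<close> to \<open>x\<close>, or a walk from \<open>u\<close> to \<open>v\<close> that avoids \<open>uv\<close>.
\<close>

lemma girth_at_least_switch:
  assumes "sym E" "girth_at_least g E" "(u, v) \<in> E" "apart g E x v" "apart g E u y"
  shows "girth_at_least g (E - {(u, v), (v, u)} \<union> {(x, v), (v, x)} \<union> {(u, y), (y, u)})"
proof -
  let ?H = "E - {(u, v), (v, u)}"
  let ?F = "?H \<union> {(x, v), (v, x)}"
  have symH: "sym ?H" and symF: "sym ?F" using assms(1) by (auto simp: sym_def)
  have "girth_at_least g ?H" using assms(2) girth_at_least_subset by blast
  then have gF: "girth_at_least g ?F"
    using assms(4) symH by (intro girth_at_least_add_edge) (auto elim: apart_subset)
  have inE: "\<And>p q k. (p, q) \<in> ?H ^^ k \<Longrightarrow> (p, q) \<in> E ^^ k"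
    by (erule relpow_subset_mono[rotated]) auto
  have vu: "(v, u) \<in> E ^^ 1" using assms(1,3) by (auto dest: symD)
  have "(u, y) \<notin> ?F ^^ n" if n: "n + 1 < g" for n
  proof
    assume "(u, y) \<in> ?F ^^ n"
    from walk_through_new_edge[OF this] show False
    proof (elim disjE exE conjE)
      fix k assume "k \<le> n" "(u, y) \<in> ?H ^^ k"
      with assms(5) n inE show False unfolding apart_def by fastforce
    next
      fix a b assume ab: "a + b + 1 \<le> n" "(u, x) \<in> ?H ^^ a"
      then have "(v, x) \<in> E ^^ (1 + a)" using inE vu relpow_compose by metis
      then have "(x, v) \<in> E ^^ (1 + a)" using assms(1) sym_relpow_swap by metis
      moreover have "1 + a + 1 < g" using ab(1) n by linarith
      ultimately show False using assms(4) unfolding apart_def by blast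
    next
      fix a b assume ab: "a + b + 1 \<le> n" "(u, v) \<in> ?H ^^ a"
      with assms(2,3) n show False unfolding girth_at_least_def apart_def by fastforce
    qed
  qed
  then show ?thesis using girth_at_least_add_edge[OF symF gF, of u y] unfolding apart_def by blast
qed

definition ball :: "nat \<Rightarrow> 'a rel \<Rightarrow> 'a \<Rightarrow> 'a set" where
  "ball g E x = {u. \<exists>n<g. (x, u) \<in> E ^^ n}"

section \<open>Completion to prescribed degrees\<close>

definition added :: "'a rel \<Rightarrow> 'a rel \<Rightarrow> 'a rel" where
  "added E0 A = E0 \<union> A \<union> A\<inverse>"

lemma sym_added: "sym E0 \<Longrightarrow> sym (added E0 A)"
  unfolding added_def by (auto simp: sym_def)

lemma card_rel_by_fst:
  assumes "finite A" "finite X" "fst ` A \<subseteq> X"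
  shows "card A = (\<Sum>x\<in>X. card (A `` {x}))"
proof -
  have "A = Sigma X (\<lambda>x. A `` {x})" using assms(3) by force
  moreover have "finite (A `` {x})" for x using assms(1) by (rule finite_Image)
  ultimately show ?thesis using card_SigmaI[OF assms(2)] by metis
qed

text \<open>
Edges are added between \<open>X\<close> and \<open>Y\<close>, only inside classes, until each vertex has received its
prescribed number \<open>s\<close> of new edges. Take an admissible set \<open>A\<close> of new edges of maximal size. If a
vertex lacks an edge, then, as each class is balanced, both a vertex \<open>x\<close> of \<open>X\<close> and a vertex \<open>y\<close> of
\<open>Y\<close> in one class lack one. Balls being small, some \<open>u\<close> of this class is far from \<open>x\<close> and from \<open>y\<close>.
Either \<open>u\<close> lacks an edge itself and \<open>uy\<close> can be added, or it has a new edge \<open>uv\<close>, which is switched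
for \<open>xv\<close> and \<open>uy\<close>. Both contradict maximality.

The classes let the same lemma serve twice: to join the links of a column to vertices of the same
column, and to make the whole graph regular.
\<close>

lemma bipartite_completion:
  fixes E0 :: "'a rel" and X Y :: "'a set" and cls :: "'a \<Rightarrow> 'c" and s :: "'a \<Rightarrow> nat"
  assumes fin: "finite X" "finite Y" and disj: "X \<inter> Y = {}"
    and sym0: "sym E0" and girth0: "girth_at_least g E0" and g: "3 \<le> g"
    and E0: "E0 \<inter> X \<times> Y = {}"
    and pos: "\<And>u. u \<in> X \<Longrightarrow> 0 < s u"
    and balanced: "\<And>c. (\<Sum>x\<in>{x\<in>X. cls x = c}. s x) = (\<Sum>y\<in>{y\<in>Y. cls y = c}. s y)"
    and R_def: "R = {(x, y). x \<in> X \<and> y \<in> Y \<and> cls x = cls y}"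
    and adm_def: "adm = {A. A \<subseteq> R \<and> (\<forall>x\<in>X. card (A `` {x}) \<le> s x) \<and> (\<forall>y\<in>Y. card (A\<inverse> `` {y}) \<le> s y)}"
    and small: "\<And>A x y. A \<in> adm \<Longrightarrow> (x, y) \<in> R \<Longrightarrow>
      card (ball g (added E0 A) x) + card (ball g (added E0 A) y) < card {u\<in>X. cls u = cls x}"
    and fin_ball: "\<And>A x. A \<in> adm \<Longrightarrow> x \<in> X \<union> Y \<Longrightarrow> finite (ball g (added E0 A) x)"
  obtains A where "A \<subseteq> R" "\<And>x. x \<in> X \<Longrightarrow> card (A `` {x}) = s x"
    "\<And>y. y \<in> Y \<Longrightarrow> card (A\<inverse> `` {y}) = s y" "girth_at_least g (added E0 A)"
proof -
  define P where "P A \<longleftrightarrow> A \<in> adm \<and> girth_at_least g (added E0 A)" for A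
  have finR: "finite R" unfolding R_def by (rule finite_subset[of _ "X \<times> Y"]) (use fin in auto)
  have finA: "finite A" if "A \<in> adm" for A using that finR finite_subset unfolding adm_def by blast
  have "P {}" using girth0 unfolding P_def adm_def added_def by auto
  moreover have "card A < card R + 1" if "P A" for A
    using that finR card_mono[of R A] unfolding P_def adm_def by (simp add: less_Suc_eq_le)
  ultimately obtain A where A: "P A" and max: "\<And>B. P B \<Longrightarrow> card B \<le> card A"
    using ex_has_greatest_nat[of P "{}" card "card R + 1"] by (metis less_imp_le)
  have adm: "A \<in> adm" and gA: "girth_at_least g (added E0 A)" using A unfolding P_def by auto
  have AR: "A \<subseteq> R" and degX: "\<And>x. x \<in> X \<Longrightarrow> card (A `` {x}) \<le> s x"
    and degY: "\<And>y. y \<in> Y \<Longrightarrow> card (A\<inverse> `` {y}) \<le> s y"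
    using adm unfolding adm_def by auto
  note fA = finA[OF adm]
  let ?E = "added E0 A"
  have symE: "sym ?E" using sym0 by (rule sym_added)

  have swap_card: "card (insert b (S - {a})) \<le> card S" if "finite S" "a \<in> S" for S and a b :: 'a
    using that card_insert_le_m1[of "card S" "S - {a}" b] by (auto simp: card_gt_0_iff)
  have no_pair: False
    if xy: "(x, y) \<in> R" and dx: "card (A `` {x}) < s x" and dy: "card (A\<inverse> `` {y}) < s y" for x y
  proof -
    have xX: "x \<in> X" and yY: "y \<in> Y" and cxy: "cls x = cls y" using xy unfolding R_def by auto
    have "\<not> {u\<in>X. cls u = cls x} \<subseteq> ball g ?E x \<union> ball g ?E y"
    proof
      assume "{u\<in>X. cls u = cls x} \<subseteq> ball g ?E x \<union> ball g ?E y"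
      then have "card {u\<in>X. cls u = cls x} \<le> card (ball g ?E x \<union> ball g ?E y)"
        using fin_ball[OF adm] xX yY by (intro card_mono) auto
      also have "\<dots> \<le> card (ball g ?E x) + card (ball g ?E y)" by (rule card_Un_le)
      finally show False using small[OF adm xy] by simp
    qed
    then obtain u where u: "u \<in> X" "cls u = cls x" "u \<notin> ball g ?E x" "u \<notin> ball g ?E y" by auto
    have fx: "\<And>n. n < g \<Longrightarrow> (x, u) \<notin> ?E ^^ n" and fy: "\<And>n. n < g \<Longrightarrow> (y, u) \<notin> ?E ^^ n"
      using u(3,4) unfolding ball_def by auto
    have apuy: "apart g ?E u y" using fy sym_relpow_swap[OF symE, of u y] unfolding apart_def
      using add_lessD1 by blast
    have ux: "u \<noteq> x" using fx[of 0] g by auto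
    have uyE: "(u, y) \<notin> ?E"
    proof
      assume "(u, y) \<in> ?E"
      then have "(u, y) \<in> ?E ^^ 1" by simp
      moreover have "1 + 1 < g" using g by simp
      ultimately show False using apuy unfolding apart_def by blast
    qed
    have uyA: "(u, y) \<notin> A" using uyE unfolding added_def by auto
    have uyR: "(u, y) \<in> R" using u yY cxy unfolding R_def by auto
    show False
    proof (cases "card (A `` {u}) < s u")
      case True
      let ?B = "insert (u, y) A"
      have "?B `` {x'} = (if x' = u then insert y (A `` {u}) else A `` {x'})" for x' by auto
      then have "\<forall>x'\<in>X. card (?B `` {x'}) \<le> s x'"
        using degX True by (auto simp: card_insert_if finite_Image fA)
      moreover have "?B\<inverse> `` {y'} = (if y' = y then insert u (A\<inverse> `` {y}) else A\<inverse> `` {y'})" for y' by auto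
      then have "\<forall>y'\<in>Y. card (?B\<inverse> `` {y'}) \<le> s y'"
        using degY dy by (auto simp: card_insert_if finite_Image fA)
      ultimately have "?B \<in> adm" using AR uyR unfolding adm_def by auto
      moreover have "added E0 ?B = ?E \<union> {(u, y), (y, u)}" unfolding added_def by auto
      then have "girth_at_least g (added E0 ?B)"
        using girth_at_least_add_edge[OF symE gA apuy] by simp
      ultimately have "card ?B \<le> card A" using max unfolding P_def by auto
      then show False using uyA fA by simp
    next
      case False
      then have "A `` {u} \<noteq> {}" using pos[OF u(1)] by auto
      then obtain v where v: "(u, v) \<in> A" by auto
      have vY: "v \<in> Y" and cv: "cls v = cls u" using v AR unfolding R_def by auto
      have uvE: "(u, v) \<in> ?E" "(v, u) \<in> ?E" using v unfolding added_def by auto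
      have vy: "v \<noteq> y" using v uyA by auto
      \<comment> \<open>The vertex u was taken at distance at least g from x, one more than is needed for u itself, so
        that its neighbour v is still far enough from x.\<close>
      have apxv: "apart g ?E x v" unfolding apart_def
      proof (intro allI impI notI)
        fix n assume "n + 1 < g" "(x, v) \<in> ?E ^^ n"
        then have "(x, u) \<in> ?E ^^ Suc n" using uvE by auto
        with fx[of "Suc n"] \<open>n + 1 < g\<close> show False by auto
      qed
      have "(x, v) \<notin> A"
      proof
        assume "(x, v) \<in> A"
        then have "(x, v) \<in> ?E ^^ 1" unfolding added_def by auto
        then have "(x, u) \<in> ?E ^^ Suc 1" using uvE(2) by (rule relpow_Suc_I)
        then show False using fx[of "Suc 1"] g by simp
      qed
      have xvR: "(x, v) \<in> R" using xX vY cv u(2) unfolding R_def by auto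
      let ?B = "insert (x, v) (insert (u, y) (A - {(u, v)}))"
      have uvX: "u \<notin> Y" "x \<notin> Y" "v \<notin> X" "y \<notin> X" using u(1) xX vY yY disj by auto
      have "card (?B `` {x'}) \<le> s x'" if "x' \<in> X" for x'
      proof -
        have "?B `` {x'} = (if x' = u then insert y (A `` {u} - {v})
            else if x' = x then insert v (A `` {x}) else A `` {x'})"
          using ux by auto
        moreover have "card (insert y (A `` {u} - {v})) \<le> s u"
          using swap_card[of "A `` {u}" v y] degX[OF u(1)] v fA by (simp add: finite_Image)
        ultimately show ?thesis
          using degX[OF that] dx by (auto simp: card_insert_if finite_Image fA)
      qed
      moreover have "card (?B\<inverse> `` {y'}) \<le> s y'" if "y' \<in> Y" for y'
      proof -
        have "?B\<inverse> `` {y'} = (if y' = v then insert x (A\<inverse> `` {v} - {u})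
            else if y' = y then insert u (A\<inverse> `` {y}) else A\<inverse> `` {y'})"
          using vy by auto
        moreover have "card (insert x (A\<inverse> `` {v} - {u})) \<le> s v"
          using swap_card[of "A\<inverse> `` {v}" u x] degY[OF vY] v fA by (simp add: finite_Image)
        ultimately show ?thesis
          using degY[OF that] dy by (auto simp: card_insert_if finite_Image fA)
      qed
      ultimately have "?B \<in> adm" using AR uyR xvR unfolding adm_def by auto
      moreover have "(u, v) \<notin> E0" "(v, u) \<notin> E0"
        using E0 u(1) vY sym0 by (auto dest: symD)
      then have "added E0 ?B = ?E - {(u, v), (v, u)} \<union> {(x, v), (v, x)} \<union> {(u, y), (y, u)}"
        unfolding added_def using uvX AR R_def by auto
      then have "girth_at_least g (added E0 ?B)"
        using girth_at_least_switch[OF symE gA uvE(1) apxv apuy] by simp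
      ultimately have "card ?B \<le> card A" using max unfolding P_def by blast
      moreover have "card ?B = card A + 1"
        using card_Suc_Diff1[OF fA v] fA \<open>(x, v) \<notin> A\<close> uyA ux
        by (simp add: card_insert_if del: card_Diff_insert)
      ultimately show False by simp
    qed
  qed

  have A_sub: "fst ` {e\<in>A. cls (fst e) = c} \<subseteq> {x\<in>X. cls x = c}"
    "fst ` ({e\<in>A. cls (fst e) = c}\<inverse>) \<subseteq> {y\<in>Y. cls y = c}" for c
    using AR unfolding R_def by auto
  \<comment> \<open>Count the new edges of a class from both sides.\<close>
  have double: "(\<Sum>x\<in>{x\<in>X. cls x = c}. card (A `` {x})) = (\<Sum>y\<in>{y\<in>Y. cls y = c}. card (A\<inverse> `` {y}))" for c
  proof -
    let ?A = "{e\<in>A. cls (fst e) = c}"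
    have "(\<Sum>x\<in>{x\<in>X. cls x = c}. card (A `` {x})) = (\<Sum>x\<in>{x\<in>X. cls x = c}. card (?A `` {x}))"
      by (intro sum.cong arg_cong[where f = card]) auto
    also have "\<dots> = card ?A"
      using card_rel_by_fst[of ?A "{x\<in>X. cls x = c}"] A_sub(1)[of c] fA fin by auto
    also have "\<dots> = card (?A\<inverse>)" by simp
    also have "\<dots> = (\<Sum>y\<in>{y\<in>Y. cls y = c}. card (?A\<inverse> `` {y}))"
      using card_rel_by_fst[of "?A\<inverse>" "{y\<in>Y. cls y = c}"] A_sub(2)[of c] fA fin by auto
    also have "\<dots> = (\<Sum>y\<in>{y\<in>Y. cls y = c}. card (A\<inverse> `` {y}))"
      using AR unfolding R_def by (intro sum.cong arg_cong[where f = card]) auto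
    finally show ?thesis .
  qed
  have deficient_pair: "(\<exists>x\<in>{x\<in>X. cls x = c}. card (A `` {x}) < s x)
      \<longleftrightarrow> (\<exists>y\<in>{y\<in>Y. cls y = c}. card (A\<inverse> `` {y}) < s y)" for c
  proof -
    have *: "(\<exists>a\<in>S. p a < q a) \<longleftrightarrow> sum p S < sum q S"
      if "finite S" "\<And>a. a \<in> S \<Longrightarrow> p a \<le> q a" for S and p q :: "'a \<Rightarrow> nat"
    proof
      assume "\<exists>a\<in>S. p a < q a"
      then show "sum p S < sum q S" using that by (intro sum_strict_mono_ex1) auto
    next
      assume lt: "sum p S < sum q S"
      show "\<exists>a\<in>S. p a < q a"
      proof (rule ccontr)
        assume "\<not> (\<exists>a\<in>S. p a < q a)"
        then have "sum q S \<le> sum p S" by (intro sum_mono) (auto simp: not_less)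
        then show False using lt by simp
      qed
    qed
    have "(\<exists>x\<in>{x\<in>X. cls x = c}. card (A `` {x}) < s x) \<longleftrightarrow>
        (\<Sum>x\<in>{x\<in>X. cls x = c}. card (A `` {x})) < (\<Sum>x\<in>{x\<in>X. cls x = c}. s x)"
      using fin degX by (intro *) auto
    moreover have "(\<exists>y\<in>{y\<in>Y. cls y = c}. card (A\<inverse> `` {y}) < s y) \<longleftrightarrow>
        (\<Sum>y\<in>{y\<in>Y. cls y = c}. card (A\<inverse> `` {y})) < (\<Sum>y\<in>{y\<in>Y. cls y = c}. s y)"
      using fin degY by (intro *) auto
    ultimately show ?thesis using double balanced by simp
  qed
  have not_both: False
    if "x \<in> {x\<in>X. cls x = c}" "card (A `` {x}) < s x" "y \<in> {y\<in>Y. cls y = c}" "card (A\<inverse> `` {y}) < s y" for x y c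
    by (rule no_pair[of x y]) (use that in \<open>auto simp: R_def\<close>)
  show ?thesis
  proof (rule that[OF AR])
    show "card (A `` {x}) = s x" if "x \<in> X" for x
    proof (rule ccontr)
      assume "card (A `` {x}) \<noteq> s x"
      then have x: "x \<in> {x'\<in>X. cls x' = cls x}" "card (A `` {x}) < s x" using degX[OF that] that by auto
      then obtain y where "y \<in> {y\<in>Y. cls y = cls x}" "card (A\<inverse> `` {y}) < s y"
        using deficient_pair[of "cls x"] by blast
      with x show False by (rule not_both)
    qed
    show "card (A\<inverse> `` {y}) = s y" if "y \<in> Y" for y
    proof (rule ccontr)
      assume "card (A\<inverse> `` {y}) \<noteq> s y"
      then have y: "y \<in> {y'\<in>Y. cls y' = cls y}" "card (A\<inverse> `` {y}) < s y" using degY[OF that] that by auto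
      then obtain x where "x \<in> {x\<in>X. cls x = cls y}" "card (A `` {x}) < s x"
        using deficient_pair[of "cls y"] by blast
      then show False using y by (rule not_both)
    qed
  qed (rule gA)
qed

section \<open>Growth of balls\<close>

text \<open>
The last arcs of the walks with \<open>n + 1\<close> steps from \<open>x\<close> that never turn back along the edge just
used.
\<close>

primrec nb_arcs :: "'a rel \<Rightarrow> 'a \<Rightarrow> nat \<Rightarrow> 'a rel" where
  "nb_arcs E x 0 = {x} \<times> (E `` {x})"
| "nb_arcs E x (Suc n) = (\<Union>(u, v)\<in>nb_arcs E x n. {v} \<times> (E `` {v} - {u}))"

lemma nb_arcs_subset: "nb_arcs E x n \<subseteq> E"
  by (cases n) auto

text \<open>
A shortest walk never turns back. The induction needs no shortest walk: if the last step turns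
back, its end was already reached two steps earlier.
\<close>

lemma relpow_in_nb_arcs:
  "(x, u) \<in> E ^^ n \<Longrightarrow> u = x \<or> (\<exists>k<n. u \<in> snd ` nb_arcs E x k)"
proof (induction n arbitrary: u)
  case (Suc n)
  then obtain v where v: "(x, v) \<in> E ^^ n" "(v, u) \<in> E" by auto
  from Suc.IH[OF v(1)] show ?case
  proof (elim disjE exE conjE)
    assume "v = x"
    with v have "u \<in> snd ` nb_arcs E x 0" by force
    then show ?thesis by blast
  next
    fix k assume k: "k < n" "v \<in> snd ` nb_arcs E x k"
    then obtain t where t: "(t, v) \<in> nb_arcs E x k" by auto
    show ?thesis
    proof (cases "u = t")
      case False
      with t v(2) have "(v, u) \<in> nb_arcs E x (Suc k)" by auto
      then have "u \<in> snd ` nb_arcs E x (Suc k)" by force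
      with k(1) show ?thesis by (meson Suc_mono)
    next
      case True
      show ?thesis
      proof (cases k)
        case 0
        with t True show ?thesis by auto
      next
        case (Suc k')
        with t True have "u \<in> snd ` nb_arcs E x k'" by force
        with k(1) Suc show ?thesis by (meson Suc_lessD less_SucI)
      qed
    qed
  qed
qed auto

text \<open>
Ball sizes are bounded by a potential: if the arcs that continue an arc have together at most
\<open>\<theta>\<close> times its weight, then the total weight of the arcs reached grows by a factor of at most \<open>\<theta>\<close>
per step. Weights that depend on the kind of arc see more than the maximal degree does. The factor
\<open>g\<close> instead of a geometric sum is harmless, since \<open>\<theta> ^ g\<close> is only needed up to a polynomial in \<open>g\<close>.
\<close>

lemma card_ball_le_weighted:
  fixes wt :: "'a \<Rightarrow> 'a \<Rightarrow> real" and \<theta> W :: real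
  assumes fin: "\<And>v. finite (E `` {v})"
    and wt1: "\<And>u v. (u, v) \<in> E \<Longrightarrow> 1 \<le> wt u v"
    and step: "\<And>u v. (u, v) \<in> E \<Longrightarrow> (\<Sum>w\<in>E `` {v} - {u}. wt v w) \<le> \<theta> * wt u v"
    and start: "(\<Sum>w\<in>E `` {x}. wt x w) \<le> W" and \<theta>: "1 \<le> \<theta>"
  shows "finite (ball g E x)" "real (card (ball g E x)) \<le> 1 + real g * W * \<theta> ^ g"
proof -
  have fin_nb: "finite (nb_arcs E x n)" for n
    by (induction n) (use fin in \<open>auto split: prod.splits\<close>)
  have W0: "0 \<le> W"
  proof -
    have "0 \<le> (\<Sum>w\<in>E `` {x}. wt x w)" using wt1 by (intro sum_nonneg) (smt (verit) Image_singleton_iff)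
    then show ?thesis using start by simp
  qed
  have weight: "(\<Sum>(u, v)\<in>nb_arcs E x n. wt u v) \<le> W * \<theta> ^ n" for n
  proof (induction n)
    case 0
    have "(\<Sum>(u, v)\<in>nb_arcs E x 0. wt u v) = (\<Sum>w\<in>E `` {x}. wt x w)"
      using fin[of x] by (simp add: sum.cartesian_product[symmetric])
    then show ?case using start by simp
  next
    case (Suc n)
    let ?N = "nb_arcs E x n"
    let ?S = "Sigma ?N (\<lambda>e. E `` {snd e} - {fst e})"
    let ?h = "\<lambda>p. (snd (fst p), snd p)"
    have fS: "finite ?S" using fin_nb fin by (intro finite_SigmaI) auto
    have img: "nb_arcs E x (Suc n) = ?h ` ?S"
    proof (intro equalityI subsetI)
      fix p assume "p \<in> nb_arcs E x (Suc n)"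
      then obtain a b y where "(a, b) \<in> ?N" "p = (b, y)" "(b, y) \<in> E" "y \<noteq> a"
        unfolding nb_arcs.simps by blast
      then have "((a, b), y) \<in> ?S" "p = ?h ((a, b), y)" by auto
      then show "p \<in> ?h ` ?S" by blast
    next
      fix p assume "p \<in> ?h ` ?S"
      then show "p \<in> nb_arcs E x (Suc n)" by fastforce
    qed
    have "(\<Sum>(u, v)\<in>?h ` ?S. wt u v) \<le> sum ((\<lambda>(u, v). wt u v) \<circ> ?h) ?S"
    proof (rule sum_image_le[OF fS])
      fix e assume "e \<in> ?S"
      then have "(snd (fst e), snd e) \<in> E" by auto
      from wt1[OF this] show "0 \<le> (case ?h e of (u, v) \<Rightarrow> wt u v)" by simp
    qed
    also have "\<dots> = (\<Sum>(e, w)\<in>?S. wt (snd e) w)"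
      by (intro sum.cong) auto
    also have "\<dots> = (\<Sum>e\<in>?N. \<Sum>w\<in>E `` {snd e} - {fst e}. wt (snd e) w)"
      using fin_nb fin by (intro sum.Sigma[symmetric]) auto
    also have "\<dots> \<le> (\<Sum>(u, v)\<in>?N. \<theta> * wt u v)"
    proof (intro sum_mono)
      fix e assume "e \<in> ?N"
      then have "(fst e, snd e) \<in> E" using nb_arcs_subset[of E x n] by auto
      from step[OF this] show "(\<Sum>w\<in>E `` {snd e} - {fst e}. wt (snd e) w) \<le> (case e of (u, v) \<Rightarrow> \<theta> * wt u v)"
        by (simp add: case_prod_unfold)
    qed
    also have "\<dots> = \<theta> * (\<Sum>(u, v)\<in>?N. wt u v)" by (simp add: sum_distrib_left case_prod_unfold)
    also have "\<dots> \<le> \<theta> * (W * \<theta> ^ n)" using Suc.IH \<theta> by (intro mult_left_mono) auto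
    finally show ?case unfolding img by (simp add: mult_ac)
  qed
  have cardN: "real (card (nb_arcs E x n)) \<le> W * \<theta> ^ g" if "n < g" for n
  proof -
    have "real (card (nb_arcs E x n)) = (\<Sum>e\<in>nb_arcs E x n. 1)" by simp
    also have "\<dots> \<le> (\<Sum>(u, v)\<in>nb_arcs E x n. wt u v)"
      using wt1 nb_arcs_subset[of E x n] by (intro sum_mono) auto
    also have "\<dots> \<le> W * \<theta> ^ n" by (rule weight)
    also have "\<dots> \<le> W * \<theta> ^ g" using W0 \<theta> that by (intro mult_left_mono power_increasing) auto
    finally show ?thesis .
  qed
  have sub: "ball g E x \<subseteq> insert x (\<Union>k<g. snd ` nb_arcs E x k)"
    unfolding ball_def using relpow_in_nb_arcs by fastforce
  have finU: "finite (\<Union>k<g. snd ` nb_arcs E x k)" using fin_nb by auto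
  then show "finite (ball g E x)" using sub finite_subset by blast
  have "card (ball g E x) \<le> card (insert x (\<Union>k<g. snd ` nb_arcs E x k))"
    using sub finU by (intro card_mono) auto
  also have "\<dots> \<le> 1 + card (\<Union>k<g. snd ` nb_arcs E x k)" using finU by (simp add: card_insert_if)
  also have "card (\<Union>k<g. snd ` nb_arcs E x k) \<le> (\<Sum>k<g. card (snd ` nb_arcs E x k))"
    by (rule card_UN_le) simp
  also have "\<dots> \<le> (\<Sum>k<g. card (nb_arcs E x k))" using fin_nb by (intro sum_mono card_image_le)
  finally have "real (card (ball g E x)) \<le> 1 + (\<Sum>k<g. real (card (nb_arcs E x k)))"
    by (simp flip: of_nat_sum)
  also have "\<dots> \<le> 1 + (\<Sum>k<g. W * \<theta> ^ g)" using cardN by (intro add_left_mono sum_mono) auto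
  finally show "real (card (ball g E x)) \<le> 1 + real g * W * \<theta> ^ g" by simp
qed

lemma card_ball_le_degree:
  assumes "sym E" "\<And>v. finite (E `` {v})" "\<And>v. card (E `` {v}) \<le> d + 1" "1 \<le> d"
  shows "finite (ball g E x)" "real (card (ball g E x)) \<le> 1 + real g * (real d + 1) * real d ^ g"
proof -
  have step: "(\<Sum>w\<in>E `` {v} - {u}. 1) \<le> real d * 1" if "(u, v) \<in> E" for u v
  proof -
    have "u \<in> E `` {v}" using that assms(1) by (auto dest: symD)
    then have "card (E `` {v} - {u}) \<le> d" using assms(2,3)[of v] by (simp add: card_Diff_singleton)
    then show ?thesis by simp
  qed
  have start: "(\<Sum>w\<in>E `` {x}. 1) \<le> real d + 1" using assms(3)[of x] by simp
  show "finite (ball g E x)"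
    by (rule card_ball_le_weighted(1)[where wt = "\<lambda>_ _. 1", OF assms(2) _ step start]) (use assms(4) in auto)
  show "real (card (ball g E x)) \<le> 1 + real g * (real d + 1) * real d ^ g"
    by (rule card_ball_le_weighted(2)[where wt = "\<lambda>_ _. 1", OF assms(2) _ step start]) (use assms(4) in auto)
qed

section \<open>Paths and links\<close>

text \<open>
\<open>Node s a i\<close> is the \<open>i\<close>-th vertex of the \<open>a\<close>-th path of sign \<open>s\<close>, counted from 0;
\<open>Link a i r\<close> is the \<open>r\<close>-th link attached to \<open>Node True a i\<close>; the fillers of either sign are the two
sides of the remaining graph.
\<close>

datatype vertex = Node bool nat nat | Link nat nat nat | Filler bool nat

definition col_nbrs :: "nat \<Rightarrow> nat \<Rightarrow> nat set" where
  "col_nbrs L i = {k. k < L \<and> (k = Suc i \<or> i = Suc k)}"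

text \<open>
What a node of the \<open>i\<close>-th column misses to degree \<open>d + 1\<close>, namely \<open>d\<close> at the ends of a path with at
least two vertices and \<open>d - 1\<close> in its interior.
\<close>

definition link_count :: "nat \<Rightarrow> nat \<Rightarrow> nat \<Rightarrow> nat" where
  "link_count d L i = d + 1 - card (col_nbrs L i)"

text \<open>
The starting graph is a forest: disjoint paths, with the links hanging as leaves from the positive
ones. The negative nodes get their links later.
\<close>

fun base_adj :: "nat \<Rightarrow> nat \<Rightarrow> nat \<Rightarrow> vertex \<Rightarrow> vertex \<Rightarrow> bool" where
  "base_adj d L N (Node s a i) (Node t b k) \<longleftrightarrow> s = t \<and> a = b \<and> a < N \<and> i < L \<and> k \<in> col_nbrs L i"
| "base_adj d L N (Node s a i) (Link b k r) \<longleftrightarrow>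
     s \<and> a = b \<and> i = k \<and> a < N \<and> i < L \<and> r < link_count d L i"
| "base_adj d L N (Link b k r) (Node s a i) \<longleftrightarrow>
     s \<and> a = b \<and> i = k \<and> a < N \<and> i < L \<and> r < link_count d L i"
| "base_adj d L N _ _ \<longleftrightarrow> False"

definition base :: "nat \<Rightarrow> nat \<Rightarrow> nat \<Rightarrow> vertex rel" where
  "base d L N = {(x, y). base_adj d L N x y}"

lemma base_iff [simp]: "(x, y) \<in> base d L N \<longleftrightarrow> base_adj d L N x y"
  by (simp add: base_def)

lemma finite_col_nbrs [simp]: "finite (col_nbrs L i)"
  unfolding col_nbrs_def by (rule finite_subset[of _ "{..<L}"]) auto

lemma card_col_nbrs: "card (col_nbrs L i) \<le> 2"
proof -
  have "col_nbrs L i \<subseteq> {Suc i, i - 1}" unfolding col_nbrs_def by auto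
  then have "card (col_nbrs L i) \<le> card {Suc i, i - 1}" by (intro card_mono) auto
  also have "\<dots> \<le> 2" by (simp add: card_insert_if)
  finally show ?thesis .
qed

lemma base_adj_sym: "base_adj d L N x y \<Longrightarrow> base_adj d L N y x"
  by (cases x; cases y) (auto simp: col_nbrs_def)

lemma sym_base: "sym (base d L N)"
  by (auto simp: sym_def intro: base_adj_sym)

lemma apart_by_cut:
  fixes E :: "'a rel"
  assumes "u \<in> C" "v \<notin> C" "\<And>x y. (x, y) \<in> E \<Longrightarrow> x \<in> C \<Longrightarrow> y \<in> C"
  shows "apart g E u v"
proof -
  have "y \<in> C" if "(u, y) \<in> E ^^ n" for n y
    using that assms(1,3) by (induction n arbitrary: y) auto
  then show ?thesis using assms(2) unfolding apart_def by blast
qed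

text \<open>
In a forest, removing an edge separates its ends, so it suffices to exhibit for each edge a set
that only this edge leaves: the initial part of a path with its links, or a single link.
\<close>

lemma girth_base: "girth_at_least g (base d L N)"
proof -
  have path: "apart g (base d L N - {(Node s a i, Node s a (Suc i)), (Node s a (Suc i), Node s a i)})
      (Node s a i) (Node s a (Suc i))" (is "apart g ?E _ _") for s a i
  proof (rule apart_by_cut)
    let ?C = "{x. case x of Node t b k \<Rightarrow> t = s \<and> b = a \<and> k \<le> i | Link b k r \<Rightarrow> s \<and> b = a \<and> k \<le> i
      | Filler _ _ \<Rightarrow> False}"
    show "Node s a i \<in> ?C" "Node s a (Suc i) \<notin> ?C" by auto
    show "y \<in> ?C" if "(x, y) \<in> ?E" "x \<in> ?C" for x y
      using that by (cases x; cases y) (auto simp: col_nbrs_def)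
  qed
  have pendant: "apart g (base d L N - {(Link a i r, Node True a i), (Node True a i, Link a i r)})
      (Link a i r) (Node True a i)" (is "apart g ?E _ _") for a i r
  proof (rule apart_by_cut)
    show "y \<in> {Link a i r}" if "(x, y) \<in> ?E" "x \<in> {Link a i r}" for x y
      using that by (cases y) auto
  qed auto
  have "apart g (base d L N - {(u, v), (v, u)}) u v" if uv: "base_adj d L N u v" for u v
  proof -
    have flip: "apart g (base d L N - {(u, v), (v, u)}) u v"
      if "apart g (base d L N - {(v, u), (u, v)}) v u" for u v
    proof -
      have "sym (base d L N - {(v, u), (u, v)})" using sym_base by (auto simp: sym_def)
      from apart_sym[OF this that] show ?thesis by (simp add: insert_commute)
    qed
    show ?thesis
    proof (cases u)
      case u: (Node s a i)
      show ?thesis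
      proof (cases v)
        case (Node t b k)
        with uv u have "v = Node s a k" "k = Suc i \<or> i = Suc k" by (auto simp: col_nbrs_def)
        then show ?thesis using path flip u by metis
      next
        case (Link b k r)
        with uv u have "u = Node True a i" "v = Link a i r" by auto
        then show ?thesis using pendant flip by metis
      qed (use uv u in auto)
    next
      case u: (Link a i r)
      with uv have "v = Node True a i" by (cases v) auto
      then show ?thesis using pendant u by metis
    qed (use uv in auto)
  qed
  then show ?thesis unfolding girth_at_least_def by auto
qed

definition nodes :: "bool \<Rightarrow> nat \<Rightarrow> nat \<Rightarrow> vertex set" where
  "nodes s L N = (\<lambda>(a, i). Node s a i) ` ({..<N} \<times> {..<L})"

definition links :: "nat \<Rightarrow> nat \<Rightarrow> nat \<Rightarrow> vertex set" where
  "links d L N = (\<lambda>(a, i, r). Link a i r) ` ({..<N} \<times> (SIGMA i:{..<L}. {..<link_count d L i}))"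

lemma nodes_iff [simp]: "x \<in> nodes s L N \<longleftrightarrow> (\<exists>a i. x = Node s a i \<and> a < N \<and> i < L)"
  unfolding nodes_def by auto

lemma links_iff [simp]: "x \<in> links d L N \<longleftrightarrow> (\<exists>a i r. x = Link a i r \<and> a < N \<and> i < L \<and> r < link_count d L i)"
  unfolding links_def by force

lemma finite_nodes [simp]: "finite (nodes s L N)" and finite_links [simp]: "finite (links d L N)"
  unfolding nodes_def links_def by auto

lemma card_nodes: "card (nodes s L N) = N * L"
  unfolding nodes_def by (subst card_image) (auto simp: inj_on_def)

lemma card_links: "card (links d L N) = N * (\<Sum>i<L. link_count d L i)"
  unfolding links_def by (subst card_image) (auto simp: inj_on_def card_cartesian_product)

fun column :: "vertex \<Rightarrow> nat" where
  "column (Node _ _ i) = i" | "column (Link _ i _) = i" | "column (Filler _ _) = 0"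

fun linking_degree :: "nat \<Rightarrow> nat \<Rightarrow> vertex \<Rightarrow> nat" where
  "linking_degree d L (Node _ _ i) = link_count d L i"
| "linking_degree d L _ = 1"

text \<open>
A partial choice of negative nodes for the links: no link is used twice, no negative node gets more
links than it misses neighbours, and columns are respected. The last point makes the values of an
eigenfunction cancel at each link.
\<close>

definition linking :: "nat \<Rightarrow> nat \<Rightarrow> nat \<Rightarrow> vertex rel \<Rightarrow> bool" where
  "linking d L N A \<longleftrightarrow> A \<subseteq> {(x, y). x \<in> links d L N \<and> y \<in> nodes False L N \<and> column x = column y} \<and>
     (\<forall>x\<in>links d L N. card (A `` {x}) \<le> 1) \<and>
     (\<forall>y\<in>nodes False L N. card (A\<inverse> `` {y}) \<le> link_count d L (column y))"

lemma nbrs_node_True: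
  assumes "linking d L N A" "a < N" "i < L"
  shows "added (base d L N) A `` {Node True a i} = Node True a ` col_nbrs L i \<union> Link a i ` {..<link_count d L i}"
proof -
  have "A `` {Node True a i} = {}" "A\<inverse> `` {Node True a i} = {}"
    using assms(1) unfolding linking_def by auto
  moreover have "base d L N `` {Node True a i} = Node True a ` col_nbrs L i \<union> Link a i ` {..<link_count d L i}" (is "?l = ?r")
  proof (rule Set.set_eqI)
    fix x show "x \<in> ?l \<longleftrightarrow> x \<in> ?r" using assms by (cases x) auto
  qed
  ultimately show ?thesis unfolding added_def by auto
qed

lemma nbrs_node_False:
  assumes "linking d L N A" "a < N" "i < L"
  shows "added (base d L N) A `` {Node False a i} = Node False a ` col_nbrs L i \<union> A\<inverse> `` {Node False a i}"
proof -
  have "A `` {Node False a i} = {}"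
    using assms(1) unfolding linking_def by auto
  moreover have "base d L N `` {Node False a i} = Node False a ` col_nbrs L i" (is "?l = ?r")
  proof (rule Set.set_eqI)
    fix x show "x \<in> ?l \<longleftrightarrow> x \<in> ?r" using assms by (cases x) auto
  qed
  ultimately show ?thesis unfolding added_def by auto
qed

lemma nbrs_link:
  assumes "linking d L N A" "Link a i r \<in> links d L N"
  shows "added (base d L N) A `` {Link a i r} = insert (Node True a i) (A `` {Link a i r})"
proof -
  have "A\<inverse> `` {Link a i r} = {}"
    using assms(1) unfolding linking_def by auto
  moreover have "base d L N `` {Link a i r} = {Node True a i}" (is "?l = ?r")
  proof (rule Set.set_eqI)
    fix x show "x \<in> ?l \<longleftrightarrow> x \<in> ?r" using assms by (cases x) auto
  qed
  ultimately show ?thesis unfolding added_def by auto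
qed

lemma added_base_vertices:
  assumes "linking d L N A" "(x, y) \<in> added (base d L N) A"
  shows "x \<in> nodes True L N \<union> nodes False L N \<union> links d L N"
proof -
  consider "base_adj d L N x y" | "(x, y) \<in> A" | "(y, x) \<in> A" using assms(2) unfolding added_def by auto
  then show ?thesis
  proof cases
    case 1
    then show ?thesis by (cases x; cases y) auto
  qed (use assms(1) in \<open>auto simp: linking_def\<close>)
qed

lemma finite_linking: "linking d L N A \<Longrightarrow> finite A"
  unfolding linking_def by (rule finite_subset[of _ "links d L N \<times> nodes False L N"]) auto

lemma nbrs_node:
  assumes "linking d L N A" "a < N" "i < L"
  obtains K where "added (base d L N) A `` {Node s a i} = Node s a ` col_nbrs L i \<union> K"
    "K \<subseteq> links d L N" "card K \<le> link_count d L i" "finite K"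
proof (cases s)
  case True
  let ?K = "Link a i ` {..<link_count d L i}"
  have "?K \<subseteq> links d L N" using assms(2,3) by auto
  moreover have "card ?K \<le> link_count d L i" by (simp add: card_image inj_on_def)
  ultimately show ?thesis using that[of ?K] nbrs_node_True[OF assms] True by simp
next
  case False
  let ?K = "A\<inverse> `` {Node False a i}"
  have "?K \<subseteq> links d L N" using assms(1) unfolding linking_def by auto
  moreover have "card ?K \<le> link_count d L i"
  proof -
    have "Node False a i \<in> nodes False L N" using assms(2,3) by simp
    moreover have "\<forall>y\<in>nodes False L N. card (A\<inverse> `` {y}) \<le> link_count d L (column y)"
      using assms(1) unfolding linking_def by blast
    ultimately show ?thesis by fastforce
  qed
  moreover have "finite ?K" using finite_linking[OF assms(1)] by (simp add: finite_Image)
  ultimately show ?thesis using that[of ?K] nbrs_node_False[OF assms] False by simp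
qed

section \<open>Linking the paths without short cycles\<close>

text \<open>
The inequalities say that ball sizes in the linked columns grow like \<open>\<theta> ^ g\<close>. Give weight \<open>\<theta>\<close> to
arcs from a link to a node, \<open>1\<close> to arcs from a node to a link and \<open>P = (\<theta>\<^sup>2 - d + 2) / 2\<close> to arcs inside
a path. The arcs that continue an arc from a link have weight at most
\<open>2 * P + (d - 2) = \<theta> * \<theta>\<close>, which explains \<open>P\<close>; those that continue an arc inside a path have weight at
most \<open>P + (d - 1)\<close>, and the last inequality bounds this by \<open>\<theta> * P\<close>. The strict bound
\<open>\<theta>\<^sup>2 < 2 * d - 1\<close> saves a power of the number of vertices, which pays for the length of the paths.
\<close>

definition growth_rate :: "nat \<Rightarrow> real \<Rightarrow> bool" where
  "growth_rate d \<theta> \<longleftrightarrow> 1 < \<theta> \<and> real d \<le> \<theta>\<^sup>2 \<and> \<theta>\<^sup>2 < 2 * real d - 1 \<and>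
     2 * (real d - 1) \<le> (\<theta> - 1) * (\<theta>\<^sup>2 - real d + 2)"

fun is_node :: "vertex \<Rightarrow> bool" where
  "is_node (Node _ _ _) \<longleftrightarrow> True" | "is_node _ \<longleftrightarrow> False"

lemma link_count_add: "2 \<le> d \<Longrightarrow> card (col_nbrs L i) + link_count d L i = d + 1"
  using card_col_nbrs[of L i] unfolding link_count_def by simp

lemma link_count_pos: "2 \<le> d \<Longrightarrow> 0 < link_count d L i"
  using card_col_nbrs[of L i] unfolding link_count_def by simp

lemma linked_vertex_cases:
  assumes "linking d L N A" "(x, y) \<in> added (base d L N) A"
  obtains s a i where "x = Node s a i" "a < N" "i < L" | a i r where "x = Link a i r" "x \<in> links d L N"
  using added_base_vertices[OF assms] by auto

lemma finite_nbrs_linked: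
  assumes "linking d L N A" shows "finite (added (base d L N) A `` {v})"
proof (cases "added (base d L N) A `` {v} = {}")
  case False
  then obtain y where vy: "(v, y) \<in> added (base d L N) A" by auto
  show ?thesis
  proof (rule linked_vertex_cases[OF assms vy])
    fix s a i assume "v = Node s a i" "a < N" "i < L"
    then show ?thesis using nbrs_node[OF assms, of a i s]
      by (metis finite_UnI finite_col_nbrs finite_imageI)
  next
    fix a i r assume "v = Link a i r" "v \<in> links d L N"
    then show ?thesis using nbrs_link[OF assms, of a i r] finite_linking[OF assms] by (simp add: finite_Image)
  qed
qed simp

lemma card_nbrs_linked:
  assumes "linking d L N A" "2 \<le> d"
  shows "card (added (base d L N) A `` {v}) \<le> d + 1"
proof (cases "added (base d L N) A `` {v} = {}")
  case False
  then obtain y where vy: "(v, y) \<in> added (base d L N) A" by auto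
  show ?thesis
  proof (rule linked_vertex_cases[OF assms(1) vy])
    fix s a i assume v: "v = Node s a i" "a < N" "i < L"
    obtain K where K: "added (base d L N) A `` {Node s a i} = Node s a ` col_nbrs L i \<union> K"
      "card K \<le> link_count d L i" using nbrs_node[OF assms(1) v(2,3)] by metis
    have "card (Node s a ` col_nbrs L i \<union> K) \<le> card (Node s a ` col_nbrs L i) + card K" by (rule card_Un_le)
    also have "\<dots> \<le> card (col_nbrs L i) + link_count d L i"
      using K(2) by (intro add_mono card_image_le) auto
    finally show ?thesis using K(1) v(1) link_count_add[OF assms(2), of L i] by simp
  next
    fix a i r assume v: "v = Link a i r" "v \<in> links d L N"
    then have "card (A `` {v}) \<le> 1" using assms(1) unfolding linking_def by blast
    then show ?thesis using nbrs_link[OF assms(1), of a i r] v finite_linking[OF assms(1)] assms(2)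
      by (simp add: finite_Image card_insert_if)
  qed
qed simp

lemma growth_rate_bounds:
  assumes "growth_rate d \<theta>" "2 \<le> d"
  defines "P \<equiv> (\<theta>\<^sup>2 - real d + 2) / 2"
  shows "1 \<le> P" "P \<le> real d + 1" "\<theta> \<le> real d + 1" "P + (real d - 1) \<le> \<theta> * P" "2 * P + (real d - 2) = \<theta> * \<theta>"
    "1 \<le> \<theta>"
proof -
  have g: "1 < \<theta>" "real d \<le> \<theta>\<^sup>2" "\<theta>\<^sup>2 < 2 * real d - 1"
    "2 * (real d - 1) \<le> (\<theta> - 1) * (\<theta>\<^sup>2 - real d + 2)"
    using assms(1) unfolding growth_rate_def by auto
  show "1 \<le> P" "P \<le> real d + 1" "2 * P + (real d - 2) = \<theta> * \<theta>" "1 \<le> \<theta>"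
    using g unfolding P_def by (auto simp: power2_eq_square field_simps)
  have "2 * real d - 1 \<le> (real d + 1)\<^sup>2" by (simp add: power2_eq_square algebra_simps)
  then have "\<theta>\<^sup>2 \<le> (real d + 1)\<^sup>2" using g(3) by linarith
  then show "\<theta> \<le> real d + 1" by (rule power2_le_imp_le) simp
  show "P + (real d - 1) \<le> \<theta> * P" using g(4) unfolding P_def by (simp add: field_simps)
qed

text \<open>
A step from path to path costs two edges, so the graph expands more slowly than its
degree \<open>d + 1\<close> suggests; with the weights explained at \<open>growth_rate\<close> the general bound applies.
\<close>

lemma card_ball_linked:
  assumes lk: "linking d L N A" and d: "2 \<le> d" and gr: "growth_rate d \<theta>"
  shows "finite (ball g (added (base d L N) A) x)"
    "real (card (ball g (added (base d L N) A) x)) \<le> 1 + real g * (real d + 1)\<^sup>2 * \<theta> ^ g"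
proof -
  let ?E = "added (base d L N) A"
  define P where "P = (\<theta>\<^sup>2 - real d + 2) / 2"
  note P = growth_rate_bounds[OF gr d, folded P_def]
  define wt where "wt u v = (if \<not> is_node u then \<theta> else if is_node v then P else 1)" for u v
  have wt1: "1 \<le> wt u v" and wt_le: "wt u v \<le> real d + 1" for u v
    using P d unfolding wt_def by auto
  have step: "(\<Sum>w\<in>?E `` {v} - {u}. wt v w) \<le> \<theta> * wt u v" if uv: "(u, v) \<in> ?E" for u v
  proof -
    have vu: "(v, u) \<in> ?E" using symD[OF sym_added[OF sym_base] uv] .
    show ?thesis
    proof (rule linked_vertex_cases[OF lk vu])
      fix s a i assume v: "v = Node s a i" "a < N" "i < L"
      let ?M = "Node s a ` col_nbrs L i"
      obtain K where K: "?E `` {v} = ?M \<union> K" "K \<subseteq> links d L N" "card K \<le> link_count d L i" "finite K"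
        using nbrs_node[OF lk v(2,3), of s] v(1) by metis
      have cM: "card ?M = card (col_nbrs L i)" by (simp add: card_image inj_on_def)
      have c: "real (card ?M) \<le> 2" "real (card ?M) + real (card K) \<le> real d + 1"
        using card_col_nbrs[of L i] link_count_add[OF d, of L i] K(3) unfolding cM by auto
      have disj: "?M \<inter> K = {}" using K(2) by auto
      have sumM: "(\<Sum>w\<in>S. wt v w) = real (card S) * P" if "S \<subseteq> ?M" for S
      proof -
        have "(\<Sum>w\<in>S. wt v w) = (\<Sum>w\<in>S. P)" using that v(1) by (intro sum.cong) (auto simp: wt_def)
        then show ?thesis by simp
      qed
      have sumK: "(\<Sum>w\<in>S. wt v w) = real (card S)" if "S \<subseteq> K" for S
      proof -
        have "(\<Sum>w\<in>S. wt v w) = (\<Sum>w\<in>S. 1)"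
        proof (intro sum.cong refl)
          fix w assume "w \<in> S"
          then have "w \<in> links d L N" using that K(2) by blast
          then show "wt v w = 1" using v(1) by (auto simp: wt_def)
        qed
        then show ?thesis by simp
      qed
      have "?E `` {v} - {u} = (?M - {u}) \<union> (K - {u})" using K(1) by auto
      then have "(\<Sum>w\<in>?E `` {v} - {u}. wt v w) = (\<Sum>w\<in>?M - {u}. wt v w) + (\<Sum>w\<in>K - {u}. wt v w)"
        using disj K(4) by (subst sum.union_disjoint[symmetric]) auto
      then have sum: "(\<Sum>w\<in>?E `` {v} - {u}. wt v w) = real (card (?M - {u})) * P + real (card (K - {u}))"
        using sumM[of "?M - {u}"] sumK[of "K - {u}"] by simp
      have "u \<in> ?M \<or> u \<in> K" using vu K(1) by auto
      then show ?thesis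
      proof
        assume u: "u \<in> ?M"
        then have eqK: "K - {u} = K" using disj by auto
        have eqM: "real (card (?M - {u})) = real (card ?M) - 1"
          using u card_Suc_Diff1[of ?M u] by (simp del: card_Diff_insert add: of_nat_Suc[symmetric])
        \<comment> \<open>As P is at least 1, path neighbours weigh at least as much as links, so two of them are the worst case.\<close>
        have "(real (card ?M) - 2) * (P - 1) \<le> 0"
          using c P(1) by (intro mult_nonpos_nonneg) auto
        then have "(\<Sum>w\<in>?E `` {v} - {u}. wt v w) \<le> P + (real d - 1)"
          using c(2) unfolding sum eqK eqM by (simp add: algebra_simps)
        moreover have "wt u v = P" using u v(1) by (auto simp: wt_def)
        ultimately show ?thesis using P(4) by simp
      next
        assume u: "u \<in> K"
        then have eqM: "?M - {u} = ?M" using disj by auto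
        have eqK: "real (card (K - {u})) = real (card K) - 1"
          using u K(4) card_Suc_Diff1[of K u] by (simp del: card_Diff_insert add: of_nat_Suc[symmetric])
        have "(real (card ?M) - 2) * (P - 1) \<le> 0"
          using c P(1) by (intro mult_nonpos_nonneg) auto
        then have "(\<Sum>w\<in>?E `` {v} - {u}. wt v w) \<le> 2 * P + (real d - 2)"
          using c(2) unfolding sum eqM eqK by (simp add: algebra_simps)
        moreover have "u \<in> links d L N" using u K(2) by blast
        then have "wt u v = \<theta>" by (auto simp: wt_def)
        ultimately show ?thesis using P(5) by simp
      qed
    next
      fix a i r assume v: "v = Link a i r" "v \<in> links d L N"
      have E: "?E `` {v} = insert (Node True a i) (A `` {v})" using nbrs_link[OF lk] v by simp
      have "card (A `` {v}) \<le> 1" using lk v(2) unfolding linking_def by blast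
      then have "card (?E `` {v}) \<le> 2"
        using E finite_linking[OF lk] by (simp add: finite_Image card_insert_if)
      then have "card (?E `` {v} - {u}) \<le> 1"
        using vu finite_nbrs_linked[OF lk, of v] by (simp add: card_Diff_singleton)
      moreover have "(\<Sum>w\<in>?E `` {v} - {u}. wt v w) = real (card (?E `` {v} - {u})) * \<theta>"
        using v(1) by (simp add: wt_def)
      moreover have "is_node u"
      proof -
        have "A `` {v} \<subseteq> nodes False L N" using lk unfolding linking_def by blast
        moreover have "u \<in> ?E `` {v}" using vu by (rule ImageI) simp
        ultimately have "u \<in> insert (Node True a i) (nodes False L N)" unfolding E by blast
        then show ?thesis by auto
      qed
      then have "wt u v = 1" using v(1) by (simp add: wt_def)
      ultimately show ?thesis using P(6) by (simp add: mult_left_le_one_le)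
    qed
  qed
  have start: "(\<Sum>w\<in>?E `` {x}. wt x w) \<le> (real d + 1)\<^sup>2"
  proof -
    have "(\<Sum>w\<in>?E `` {x}. wt x w) \<le> real (card (?E `` {x})) * (real d + 1)"
      using wt_le by (intro sum_bounded_above) auto
    also have "\<dots> \<le> (real d + 1) * (real d + 1)"
      using card_nbrs_linked[OF lk d, of x] by (intro mult_right_mono) auto
    finally show ?thesis by (simp add: power2_eq_square)
  qed
  show "finite (ball g ?E x)"
    by (rule card_ball_le_weighted(1)[where wt = wt, OF finite_nbrs_linked[OF lk] wt1 step start P(6)])
  show "real (card (ball g ?E x)) \<le> 1 + real g * (real d + 1)\<^sup>2 * \<theta> ^ g"
    by (rule card_ball_le_weighted(2)[where wt = wt, OF finite_nbrs_linked[OF lk] wt1 step start P(6)])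
qed

lemma link_class: "{x \<in> links d L N. column x = c} =
    (if c < L then (\<lambda>(a, r). Link a c r) ` ({..<N} \<times> {..<link_count d L c}) else {})"
  by (auto simp: image_iff)

lemma node_class: "{x \<in> nodes s L N. column x = c} = (if c < L then (\<lambda>a. Node s a c) ` {..<N} else {})"
  by (auto simp: image_iff)

lemma card_link_class: "c < L \<Longrightarrow> card {x \<in> links d L N. column x = c} = N * link_count d L c"
  unfolding link_class by (simp, subst card_image) (auto simp: inj_on_def)

text \<open>
All links find their negative nodes as soon as a column, with at least \<open>N\<close> links, exceeds two balls.
The classes of the switching lemma are the columns; each is balanced, since positive and
negative nodes of a column miss the same number of neighbours.
\<close>

lemma linked_columns_exist:
  assumes d: "2 \<le> d" and gr: "growth_rate d \<theta>" and g: "3 \<le> g"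
    and N: "2 * (1 + real g * (real d + 1)\<^sup>2 * \<theta> ^ g) < real N"
  obtains A where "linking d L N A" "girth_at_least g (added (base d L N) A)"
    "\<And>x. x \<in> links d L N \<Longrightarrow> card (A `` {x}) = 1"
    "\<And>y. y \<in> nodes False L N \<Longrightarrow> card (A\<inverse> `` {y}) = link_count d L (column y)"
proof -
  let ?X = "links d L N" and ?Y = "nodes False L N" and ?s = "linking_degree d L"
  define R where "R = {(x, y). x \<in> ?X \<and> y \<in> ?Y \<and> column x = column y}"
  define adm where "adm = {A. A \<subseteq> R \<and> (\<forall>x\<in>?X. card (A `` {x}) \<le> ?s x) \<and> (\<forall>y\<in>?Y. card (A\<inverse> `` {y}) \<le> ?s y)}"
  have s: "\<And>x. x \<in> ?X \<Longrightarrow> ?s x = 1" "\<And>y. y \<in> ?Y \<Longrightarrow> ?s y = link_count d L (column y)" by auto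
  have adm_iff: "A \<in> adm \<longleftrightarrow> linking d L N A" for A
    unfolding adm_def linking_def R_def using s by auto
  have small: "card (ball g (added (base d L N) A) x) + card (ball g (added (base d L N) A) y)
      < card {u \<in> ?X. column u = column x}" if "A \<in> adm" "(x, y) \<in> R" for A x y
  proof -
    have lk: "linking d L N A" using that(1) adm_iff by simp
    have "column x < L" using that(2) unfolding R_def by auto
    then have card: "N \<le> card {u \<in> ?X. column u = column x}"
      using link_count_pos[OF d, of L "column x"] by (subst card_link_class) auto
    have "real (card (ball g (added (base d L N) A) x)) + real (card (ball g (added (base d L N) A) y))
        \<le> 2 * (1 + real g * (real d + 1)\<^sup>2 * \<theta> ^ g)"
      using card_ball_linked(2)[OF lk d gr, of g x] card_ball_linked(2)[OF lk d gr, of g y] by simp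
    then show ?thesis using N card by linarith
  qed
  have balanced: "(\<Sum>x\<in>{x \<in> ?X. column x = c}. ?s x) = (\<Sum>y\<in>{y \<in> ?Y. column y = c}. ?s y)" for c
  proof (cases "c < L")
    case True
    have "(\<Sum>x\<in>{x \<in> ?X. column x = c}. ?s x) = (\<Sum>x\<in>{x \<in> ?X. column x = c}. 1)"
      using s(1) by (intro sum.cong) blast+
    moreover have "(\<Sum>y\<in>{y \<in> ?Y. column y = c}. ?s y) = (\<Sum>y\<in>{y \<in> ?Y. column y = c}. link_count d L c)"
      using s(2) by (intro sum.cong) auto
    moreover have "card {y \<in> ?Y. column y = c} = N"
      using True unfolding node_class by (simp add: card_image inj_on_def)
    ultimately show ?thesis using card_link_class[OF True, of d N] by simp
  next
    case False
    then show ?thesis unfolding link_class node_class by simp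
  qed
  show ?thesis
  proof (rule bipartite_completion[OF finite_links finite_nodes _ sym_base girth_base g _ _ balanced R_def adm_def small])
    show "?X \<inter> ?Y = {}" "base d L N \<inter> ?X \<times> ?Y = {}" by auto
    show "0 < ?s u" if "u \<in> ?X" for u using s(1)[OF that] by simp
    show "finite (ball g (added (base d L N) A) x)" if "A \<in> adm" for A x
      using card_ball_linked(1)[OF _ d gr] that adm_iff by simp
    fix A assume A: "A \<subseteq> R" "\<And>x. x \<in> ?X \<Longrightarrow> card (A `` {x}) = ?s x"
      "\<And>y. y \<in> ?Y \<Longrightarrow> card (A\<inverse> `` {y}) = ?s y" "girth_at_least g (added (base d L N) A)"
    have "A \<in> adm" using A unfolding adm_def by simp
    then show ?thesis using that[of A] A s adm_iff by simp
  qed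
qed

section \<open>Completion to a regular graph with eigenfunctions\<close>

definition fillers :: "bool \<Rightarrow> nat \<Rightarrow> vertex set" where
  "fillers s p = Filler s ` {..<p}"

lemma fillers_iff [simp]: "x \<in> fillers s p \<longleftrightarrow> (\<exists>j<p. x = Filler s j)"
  unfolding fillers_def by auto

lemma finite_fillers [simp]: "finite (fillers s p)"
  unfolding fillers_def by simp

lemma card_fillers: "card (fillers s p) = p"
  unfolding fillers_def by (simp add: card_image inj_on_def)

definition vertices :: "nat \<Rightarrow> nat \<Rightarrow> nat \<Rightarrow> nat \<Rightarrow> nat \<Rightarrow> vertex set" where
  "vertices d L N p q =
     nodes True L N \<union> nodes False L N \<union> links d L N \<union> fillers True p \<union> fillers False q"

lemma card_vertices:
  "card (vertices d L N p q) = 2 * (N * L) + N * (\<Sum>i<L. link_count d L i) + p + q"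
proof -
  have "card (vertices d L N p q) = card (nodes True L N) + card (nodes False L N) + card (links d L N)
      + card (fillers True p) + card (fillers False q)"
  proof -
    have "nodes True L N \<inter> nodes False L N = {}"
      "(nodes True L N \<union> nodes False L N) \<inter> links d L N = {}"
      "(nodes True L N \<union> nodes False L N \<union> links d L N) \<inter> fillers True p = {}"
      "(nodes True L N \<union> nodes False L N \<union> links d L N \<union> fillers True p) \<inter> fillers False q = {}"
      by auto
    then show ?thesis unfolding vertices_def by (simp add: card_Un_disjoint)
  qed
  then show ?thesis by (simp add: card_nodes card_links card_fillers)
qed

lemma vertices_cases [consumes 1]:
  assumes "v \<in> vertices d L N p q"
  obtains (T) a i where "v = Node True a i" "a < N" "i < L"
    | (F) a i where "v = Node False a i" "a < N" "i < L"
    | (K) a i r where "v = Link a i r" "v \<in> links d L N"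
    | (fT) j where "v = Filler True j" "v \<in> fillers True p"
    | (fF) j where "v = Filler False j" "v \<in> fillers False q"
  using assms unfolding vertices_def by (cases v) auto

text \<open>
The eigenfunctions: a sine wave along each positive path, its negative along each negative path, and
zero elsewhere. The shift by one places the zeros of the sine just before the first and just after
the last vertex of a path.
\<close>

fun wave :: "real \<Rightarrow> vertex \<Rightarrow> real" where
  "wave t (Node s _ i) = (if s then 1 else - 1) * sin (t * (real i + 1))"
| "wave t _ = 0"

text \<open>
The addition theorem gives the identity for the vertices \<open>i - 1\<close> and \<open>i + 1\<close>; one that does not exist
would carry the value \<open>sin 0\<close> or \<open>sin (t * (L + 1))\<close>, both zero.
\<close>

lemma sum_sin_col_nbrs:
  assumes "i < L" "sin (t * (real L + 1)) = 0"
  shows "(\<Sum>k\<in>col_nbrs L i. sin (t * (real k + 1))) = 2 * cos t * sin (t * (real i + 1))"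
proof -
  have up: "sin (t * (real i + 1) + t) + sin (t * (real i + 1) - t) = 2 * cos t * sin (t * (real i + 1))"
    by (simp add: sin_add sin_diff)
  have split: "col_nbrs L i = (if Suc i < L then {Suc i} else {}) \<union> (if i = 0 then {} else {i - 1})"
    using assms(1) unfolding col_nbrs_def by auto
  have hi: "(\<Sum>k\<in>(if Suc i < L then {Suc i} else {}). sin (t * (real k + 1))) = sin (t * (real i + 1) + t)"
  proof (cases "Suc i < L")
    case False
    then have "L = Suc i" using assms(1) by simp
    then show ?thesis using assms(2) by (simp add: algebra_simps)
  qed (simp add: algebra_simps)
  have lo: "(\<Sum>k\<in>(if i = 0 then {} else {i - 1}). sin (t * (real k + 1))) = sin (t * (real i + 1) - t)"
    by (cases i) (simp_all add: algebra_simps)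
  have "(\<Sum>k\<in>col_nbrs L i. sin (t * (real k + 1)))
      = (\<Sum>k\<in>(if Suc i < L then {Suc i} else {}). sin (t * (real k + 1)))
        + (\<Sum>k\<in>(if i = 0 then {} else {i - 1}). sin (t * (real k + 1)))"
    unfolding split by (rule sum.union_disjoint) auto
  then show ?thesis using hi lo up by simp
qed

text \<open>
The second use of the switching lemma makes the linked columns regular: each link needs \<open>d - 1\<close> and
each filler \<open>d + 1\<close> further edges, all of them between links or positive fillers and negative
fillers; the equation for \<open>q\<close> is the balance of these demands. Nodes already have full degree and are not
touched, so the wave equation at a node is the one on its path. A link sees the two values
\<open>sin\<close> and \<open>- sin\<close> of its column, and a filler only zeros.
\<close>

lemma regular_graph_with_waves:
  assumes d: "2 \<le> d" and gr: "growth_rate d \<theta>" and g: "3 \<le> g"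
    and N: "2 * (1 + real g * (real d + 1)\<^sup>2 * \<theta> ^ g) < real N"
    and p: "2 * (1 + real g * (real d + 1) * real d ^ g) < real p"
    and pq: "(d - 1) * (N * (\<Sum>i<L. link_count d L i)) + (d + 1) * p = (d + 1) * q"
  obtains E where "sym E" "girth_at_least g E" "E \<subseteq> vertices d L N p q \<times> vertices d L N p q"
    "\<And>v. v \<in> vertices d L N p q \<Longrightarrow> card (E `` {v}) = d + 1"
    "\<And>t v. sin (t * (real L + 1)) = 0 \<Longrightarrow> v \<in> vertices d L N p q \<Longrightarrow>
      (\<Sum>w\<in>E `` {v}. wave t w) = 2 * cos t * wave t v"
proof -
  obtain A1 where lk: "linking d L N A1" and g1: "girth_at_least g (added (base d L N) A1)"
    and A1x: "\<And>x. x \<in> links d L N \<Longrightarrow> card (A1 `` {x}) = 1"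
    and A1y: "\<And>y. y \<in> nodes False L N \<Longrightarrow> card (A1\<inverse> `` {y}) = link_count d L (column y)"
    using linked_columns_exist[OF d gr g N] by metis
  define E1 where "E1 = added (base d L N) A1"
  have sym1: "sym E1" unfolding E1_def by (intro sym_added sym_base)
  have A1sub: "A1 \<subseteq> {(x, y). x \<in> links d L N \<and> y \<in> nodes False L N \<and> column x = column y}"
    using lk unfolding linking_def by blast
  have fin1: "finite (E1 `` {v})" and deg1: "card (E1 `` {v}) \<le> d + 1" for v
    unfolding E1_def using finite_nbrs_linked[OF lk] card_nbrs_linked[OF lk d] by auto
  have E1v: "x \<in> nodes True L N \<union> nodes False L N \<union> links d L N" if "(x, y) \<in> E1" for x y
    using added_base_vertices[OF lk] that unfolding E1_def by blast
  have E1filler: "E1 `` {Filler s j} = {}" for s j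
    using E1v by auto
  have E1link: "E1 `` {v} = insert (Node True a i) (A1 `` {v})" "card (E1 `` {v}) = 2"
    if v: "v = Link a i r" "v \<in> links d L N" for v a i r
  proof -
    show eq: "E1 `` {v} = insert (Node True a i) (A1 `` {v})"
      unfolding E1_def using nbrs_link[OF lk] v by simp
    have "Node True a i \<notin> A1 `` {v}" using A1sub by auto
    then show "card (E1 `` {v}) = 2"
      unfolding eq using A1x[OF v(2)] finite_linking[OF lk] by (simp add: finite_Image)
  qed

  define X where "X = links d L N \<union> fillers True p"
  define Y where "Y = fillers False q"
  define s where "s v = (if v \<in> links d L N then d - 1 else d + 1)" for v
  \<comment> \<open>A single class: every link and every positive filler may be joined to every negative filler.\<close>
  let ?cls = "\<lambda>_ :: vertex. ()"
  define R where "R = {(x, y). x \<in> X \<and> y \<in> Y \<and> ?cls x = ?cls y}"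
  define adm where "adm = {A. A \<subseteq> R \<and> (\<forall>x\<in>X. card (A `` {x}) \<le> s x) \<and> (\<forall>y\<in>Y. card (A\<inverse> `` {y}) \<le> s y)}"
  have sF: "s (Filler b j) = d + 1" for b j unfolding s_def by auto
  have nbrs: "added E1 A `` {v} = E1 `` {v} \<union> A `` {v} \<union> A\<inverse> `` {v}" for A v
    unfolding added_def by auto
  have finA: "finite A" if "A \<in> adm" for A
  proof (rule finite_subset)
    show "A \<subseteq> X \<times> Y" using that unfolding adm_def R_def by auto
    show "finite (X \<times> Y)" unfolding X_def Y_def by simp
  qed
  have noA: "A `` {v} = {}" if "A \<in> adm" "v \<notin> X" for A v using that unfolding adm_def R_def by auto
  have noA': "A\<inverse> `` {v} = {}" if "A \<in> adm" "v \<notin> Y" for A v using that unfolding adm_def R_def by auto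
  have nbrs_node: "added E1 A `` {Node b a i} = E1 `` {Node b a i}" if "A \<in> adm" for A b a i
    using noA[OF that, of "Node b a i"] noA'[OF that, of "Node b a i"] unfolding nbrs X_def Y_def by auto
  have nbrs_link: "added E1 A `` {Link a i r} = E1 `` {Link a i r} \<union> A `` {Link a i r}" if "A \<in> adm" for A a i r
    using noA'[OF that, of "Link a i r"] unfolding nbrs Y_def by auto
  have nbrs_fT: "added E1 A `` {Filler True j} = A `` {Filler True j}" if "A \<in> adm" for A j
    using noA'[OF that, of "Filler True j"] E1filler unfolding nbrs Y_def by auto
  have nbrs_fF: "added E1 A `` {Filler False j} = A\<inverse> `` {Filler False j}" if "A \<in> adm" for A j
    using noA[OF that, of "Filler False j"] E1filler unfolding nbrs X_def by auto
  have fin2: "finite (added E1 A `` {v})" if "A \<in> adm" for A v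
    unfolding nbrs using fin1 finA[OF that] by (simp add: finite_Image)
  have deg2: "card (added E1 A `` {v}) \<le> d + 1" if A: "A \<in> adm" for A v
  proof -
    have degX: "card (A `` {v}) \<le> s v" if "v \<in> X" using A that unfolding adm_def by auto
    have degY: "card (A\<inverse> `` {v}) \<le> s v" if "v \<in> Y" using A that unfolding adm_def by auto
    show ?thesis
    proof (cases v)
      case (Node b a i)
      then show ?thesis using nbrs_node[OF A] deg1[of v] by simp
    next
      case v: (Link a i r)
      show ?thesis
      proof (cases "v \<in> links d L N")
        case True
        then have "card (A `` {v}) \<le> d - 1" using degX unfolding X_def s_def by simp
        then have "card (E1 `` {v} \<union> A `` {v}) \<le> 2 + (d - 1)"
          using card_Un_le[of "E1 `` {v}" "A `` {v}"] E1link(2)[OF v True] by linarith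
        then show ?thesis using nbrs_link[OF A] v d by simp
      next
        case False
        then have "v \<notin> X" using v unfolding X_def by auto
        then show ?thesis using nbrs_link[OF A, of a i r] noA[OF A] v deg1[of v] by simp
      qed
    next
      case v: (Filler b j)
      show ?thesis
      proof (cases b)
        case True
        then show ?thesis using nbrs_fT[OF A, of j] noA[OF A, of v] degX v sF by (cases "v \<in> X") auto
      next
        case False
        then show ?thesis using nbrs_fF[OF A, of j] noA'[OF A, of v] degY v sF by (cases "v \<in> Y") auto
      qed
    qed
  qed
  have ball2: "finite (ball g (added E1 A) v)"
    "real (card (ball g (added E1 A) v)) \<le> 1 + real g * (real d + 1) * real d ^ g" if A: "A \<in> adm" for A v
    using card_ball_le_degree[OF sym_added[OF sym1] fin2[OF A] deg2[OF A], where g = g and x = v] d by auto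
  have cardX: "p \<le> card {u \<in> X. () = ()}"
  proof -
    have "fillers True p \<subseteq> X" "finite X" unfolding X_def by (blast, simp)
    then have "p \<le> card X" using card_mono[of X "fillers True p"] card_fillers[of True p] by simp
    then show ?thesis by simp
  qed
  have small: "card (ball g (added E1 A) x) + card (ball g (added E1 A) y) < card {u \<in> X. ?cls u = ?cls x}"
    if "A \<in> adm" "(x, y) \<in> R" for A x y
  proof -
    have "real (card (ball g (added E1 A) x)) + real (card (ball g (added E1 A) y))
        \<le> 2 * (1 + real g * (real d + 1) * real d ^ g)"
      using ball2(2)[OF that(1), of x] ball2(2)[OF that(1), of y] by simp
    then have "card (ball g (added E1 A) x) + card (ball g (added E1 A) y) < p" using p by linarith
    then show ?thesis using cardX by (rule less_le_trans)
  qed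
  have balanced: "(\<Sum>x\<in>{x \<in> X. ?cls x = c}. s x) = (\<Sum>y\<in>{y \<in> Y. ?cls y = c}. s y)" for c
  proof -
    have "(\<Sum>x\<in>X. s x) = (\<Sum>x\<in>links d L N. s x) + (\<Sum>x\<in>fillers True p. s x)"
      unfolding X_def by (rule sum.union_disjoint) auto
    also have "(\<Sum>x\<in>links d L N. s x) = (\<Sum>x\<in>links d L N. d - 1)"
      by (intro sum.cong) (simp_all add: s_def)
    also have "(\<Sum>x\<in>fillers True p. s x) = (\<Sum>x\<in>fillers True p. d + 1)"
      by (intro sum.cong) (auto simp: sF)
    also have "(\<Sum>x\<in>links d L N. d - 1) + (\<Sum>x\<in>fillers True p. d + 1) = (d + 1) * q"
      using pq by (simp add: card_links card_fillers mult.commute)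
    also have "\<dots> = (\<Sum>x\<in>Y. d + 1)" unfolding Y_def by (simp add: card_fillers)
    also have "\<dots> = (\<Sum>x\<in>Y. s x)" unfolding Y_def by (intro sum.cong) (auto simp: sF)
    finally show ?thesis by simp
  qed
  obtain A where AR: "A \<subseteq> R" and Ax: "\<And>x. x \<in> X \<Longrightarrow> card (A `` {x}) = s x"
    and Ay: "\<And>y. y \<in> Y \<Longrightarrow> card (A\<inverse> `` {y}) = s y" and gA: "girth_at_least g (added E1 A)"
  proof (rule bipartite_completion[OF _ _ _ sym1 _ g _ _ balanced R_def adm_def small])
    show "finite X" "finite Y" "X \<inter> Y = {}" unfolding X_def Y_def by auto
    show "girth_at_least g E1" using g1 unfolding E1_def .
    have "(x, y) \<notin> E1" if "y \<in> Y" for x y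
      using E1filler symD[OF sym1, of x y] that unfolding Y_def by auto
    then show "E1 \<inter> X \<times> Y = {}" by auto
    show "0 < s u" for u using d unfolding s_def by simp
    show "finite (ball g (added E1 A) x)" if "A \<in> adm" for A x using ball2(1)[OF that] .
  qed (assumption | rule that)+
  have A: "A \<in> adm" using AR Ax Ay unfolding adm_def by simp
  let ?E = "added E1 A" and ?V = "vertices d L N p q"
  have symE: "sym ?E" by (rule sym_added[OF sym1])
  have inV: "v \<in> ?V" if "(v, w) \<in> ?E" for v w
  proof -
    have "(v, w) \<in> E1 \<or> v \<in> X \<or> v \<in> Y" using that AR unfolding added_def R_def by auto
    then show ?thesis using E1v unfolding vertices_def X_def Y_def by blast
  qed
  have EV: "?E \<subseteq> ?V \<times> ?V"
  proof clarify
    fix x y assume "(x, y) \<in> ?E"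
    then show "x \<in> ?V \<and> y \<in> ?V" using inV[of x y] inV[of y x] symD[OF symE] by blast
  qed

  have nodesT: "E1 `` {Node True a i} = Node True a ` col_nbrs L i \<union> Link a i ` {..<link_count d L i}"
    and nodesF: "E1 `` {Node False a i} = Node False a ` col_nbrs L i \<union> A1\<inverse> `` {Node False a i}"
    if "a < N" "i < L" for a i
    unfolding E1_def using nbrs_node_True[OF lk that] nbrs_node_False[OF lk that] by auto
  have A1inv: "A1\<inverse> `` {v} \<subseteq> links d L N" for v using A1sub by auto
  have finA1: "finite (A1\<inverse> `` {v})" for v using finite_linking[OF lk] by (simp add: finite_Image)
  have wave_links: "wave t w = 0" if "w \<in> links d L N" for t w using that by auto
  have img_node: "card (Node b a ` S) = card S" "(\<Sum>w\<in>Node b a ` S. h w) = (\<Sum>k\<in>S. h (Node b a k))"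
    for a b S and h :: "vertex \<Rightarrow> real"
    by (auto simp: card_image inj_on_def sum.reindex)
  have degE: "card (?E `` {v}) = d + 1" if "v \<in> ?V" for v
    using that
  proof (cases rule: vertices_cases)
    case (T a i)
    have "card (?E `` {v}) = card (Node True a ` col_nbrs L i) + card (Link a i ` {..<link_count d L i})"
      unfolding T(1) nbrs_node[OF A] nodesT[OF T(2,3)] by (rule card_Un_disjoint) auto
    then show ?thesis using link_count_add[OF d, of L i] by (simp add: img_node card_image inj_on_def)
  next
    case (F a i)
    have "card (?E `` {v}) = card (Node False a ` col_nbrs L i) + card (A1\<inverse> `` {v})"
      unfolding F(1) nbrs_node[OF A] nodesF[OF F(2,3)] using A1inv finA1
      by (intro card_Un_disjoint) fastforce+
    moreover have "card (A1\<inverse> `` {v}) = link_count d L i" using A1y[of v] F by simp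
    ultimately show ?thesis using link_count_add[OF d, of L i] by (simp add: img_node)
  next
    case (K a i r)
    have "E1 `` {v} \<inter> A `` {v} = {}"
      using E1link(1)[OF K] A1sub AR unfolding R_def Y_def by auto
    then have "card (?E `` {v}) = card (E1 `` {v}) + card (A `` {v})"
      unfolding K(1) nbrs_link[OF A] using fin1 finA[OF A] by (intro card_Un_disjoint) (auto simp: finite_Image)
    moreover have "card (A `` {v}) = d - 1" using Ax[of v] K(2) unfolding X_def s_def by simp
    ultimately show ?thesis using E1link(2)[OF K] d by simp
  next
    case (fT j)
    then show ?thesis using Ax[of v] nbrs_fT[OF A] sF unfolding X_def by simp
  next
    case (fF j)
    then show ?thesis using Ay[of v] nbrs_fF[OF A] sF unfolding Y_def by simp
  qed
  have waveE: "(\<Sum>w\<in>?E `` {v}. wave t w) = 2 * cos t * wave t v"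
    if t: "sin (t * (real L + 1)) = 0" and "v \<in> ?V" for t v
    using that(2)
  proof (cases rule: vertices_cases)
    case (T a i)
    have "(\<Sum>w\<in>?E `` {v}. wave t w)
        = (\<Sum>w\<in>Node True a ` col_nbrs L i. wave t w) + (\<Sum>w\<in>Link a i ` {..<link_count d L i}. wave t w)"
      unfolding T(1) nbrs_node[OF A] nodesT[OF T(2,3)] by (rule sum.union_disjoint) auto
    also have "(\<Sum>w\<in>Link a i ` {..<link_count d L i}. wave t w) = 0" by (rule sum.neutral) auto
    finally show ?thesis using sum_sin_col_nbrs[OF T(3) t] by (simp add: img_node T(1))
  next
    case (F a i)
    have "(\<Sum>w\<in>?E `` {v}. wave t w)
        = (\<Sum>w\<in>Node False a ` col_nbrs L i. wave t w) + (\<Sum>w\<in>A1\<inverse> `` {v}. wave t w)"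
      unfolding F(1) nbrs_node[OF A] nodesF[OF F(2,3)] using A1inv finA1
      by (intro sum.union_disjoint) fastforce+
    also have "(\<Sum>w\<in>A1\<inverse> `` {v}. wave t w) = 0" using A1inv wave_links by (intro sum.neutral) blast
    finally show ?thesis using sum_sin_col_nbrs[OF F(3) t] by (simp add: img_node F(1) sum_negf)
  next
    case (K a i r)
    obtain y where y: "A1 `` {v} = {y}" using A1x[OF K(2)] card_1_singletonE by metis
    then have "(v, y) \<in> A1" by auto
    then have "\<exists>b. y = Node False b i" using A1sub K by auto
    then obtain b where b: "y = Node False b i" by blast
    have "(\<Sum>w\<in>?E `` {v}. wave t w) = (\<Sum>w\<in>{Node True a i, Node False b i}. wave t w)"
    proof (rule sum.mono_neutral_right)
      have eq: "?E `` {v} = {Node True a i, Node False b i} \<union> A `` {v}"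
        using nbrs_link[OF A, of a i r] E1link(1)[OF K] K(1) y b by auto
      show "{Node True a i, Node False b i} \<subseteq> ?E `` {v}" unfolding eq by blast
      show "\<forall>w\<in>?E `` {v} - {Node True a i, Node False b i}. wave t w = 0"
        unfolding eq using AR unfolding R_def Y_def by auto
    qed (rule fin2[OF A])
    then show ?thesis using K(1) by simp
  next
    case (fT j)
    have "\<forall>w\<in>A `` {v}. wave t w = 0" using AR unfolding R_def Y_def by auto
    then show ?thesis using fT nbrs_fT[OF A, of j] by simp
  next
    case (fF j)
    have "\<forall>w\<in>A\<inverse> `` {v}. wave t w = 0" using AR unfolding R_def X_def by auto
    then show ?thesis using fF nbrs_fF[OF A, of j] by simp
  qed
  show ?thesis by (rule that[OF symE gA EV degE waveE])
qed

section \<open>Cycles, adjacency matrices and normalized eigenvectors\<close>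

lemma pcas_relpow:
  "pcas u es v \<Longrightarrow> set es \<subseteq> F \<Longrightarrow> (u, v) \<in> F ^^ length es"
proof (induction es arbitrary: u)
  case (Cons e es)
  then have "(u, snd e) \<in> F" "(snd e, v) \<in> F ^^ length es" by (cases e; auto)+
  then show ?case unfolding length_Cons by (rule relpow_Suc_I2)
qed simp

lemma pawalk_verts_heads: "pcas u es v \<Longrightarrow> pawalk_verts u es = u # map snd es"
  by (induction es arbitrary: u) auto

lemma pcas_tails: "pcas u es v \<Longrightarrow> fst ` set es \<subseteq> insert u (snd ` set es)"
  by (induction es arbitrary: u) fastforce+

lemma pcas_last: "pcas u es v \<Longrightarrow> es \<noteq> [] \<Longrightarrow> v \<in> snd ` set es"
  by (induction es arbitrary: u) (auto, metis pcas.simps(1))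

text \<open>
Remove from a cycle its first arc \<open>uv\<close>. The rest leads from \<open>v\<close> to \<open>u\<close> and avoids both orientations
of the edge: no vertex is entered twice, and the reverse arc \<open>vu\<close> could only come second, which
makes the cycle the back-and-forth walk of length two.
\<close>

lemma girth_ge:
  assumes "sym (parcs G)" "girth_at_least g (parcs G)"
  shows "enat g \<le> girth G"
  unfolding girth_def
proof (rule INF_greatest)
  fix p assume "p \<in> {p. pre_digraph.cycle (with_proj G) p \<and> 3 \<le> length p}"
  then have len: "3 \<le> length p" and "pre_digraph.cycle (with_proj G) p" by auto
  then obtain u where sub: "set p \<subseteq> parcs G" and cas: "pcas u p u"
    and dist: "distinct (tl (pawalk_verts u p))"
    unfolding pre_digraph.cycle_def pre_digraph.awalk_def cas_with_proj_eq awalk_verts_with_proj_eq by auto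
  obtain v es where p: "p = (u, v) # es" using len cas by (cases p) auto
  have es: "pcas v es u" using cas p by simp
  have "pawalk_verts v es = v # map snd es" using pawalk_verts_heads[OF es] .
  then have v_out: "v \<notin> snd ` set es" and dist_es: "distinct (map snd es)" using dist p by auto
  obtain e es' where es_Cons: "es = e # es'" using len p by (cases es) auto
  have e: "fst e = v" "pcas (snd e) es' u" using es es_Cons by auto
  have "es' \<noteq> []" using len p es_Cons by auto
  then have u_later: "u \<in> snd ` set es'" using pcas_last[OF e(2)] by blast
  then have "snd e \<noteq> u" using dist_es es_Cons by auto
  moreover have "v \<notin> fst ` set es'"
    using pcas_tails[OF e(2)] v_out es_Cons by auto
  ultimately have "(v, u) \<notin> set es" using es_Cons by force
  moreover have "(u, v) \<notin> set es" using v_out by force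
  ultimately have sub_es: "set es \<subseteq> parcs G - {(u, v), (v, u)}" using sub p by auto
  have "sym (parcs G - {(u, v), (v, u)})" using assms(1) by (auto simp: sym_def)
  from sym_relpow_swap[OF this pcas_relpow[OF es sub_es]]
  have "(u, v) \<in> (parcs G - {(u, v), (v, u)}) ^^ length es" .
  moreover have "(u, v) \<in> parcs G" using sub p by auto
  ultimately have "\<not> length es + 1 < g"
    using assms(2) unfolding girth_at_least_def apart_def by blast
  then show "enat g \<le> enat (length p)" using p by simp
qed

lemma girth_at_least_pullback:
  assumes "girth_at_least g E" "inj_on \<psi> S"
  shows "girth_at_least g {(x, y). x \<in> S \<and> y \<in> S \<and> (\<psi> x, \<psi> y) \<in> E}" (is "girth_at_least g ?E'")
proof -
  have "(u, v) \<notin> (?E' - {(u, v), (v, u)}) ^^ n" if uv: "(u, v) \<in> ?E'" "n + 1 < g" for u v n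
  proof
    assume walk: "(u, v) \<in> (?E' - {(u, v), (v, u)}) ^^ n"
    let ?F = "E - {(\<psi> u, \<psi> v), (\<psi> v, \<psi> u)}"
    have "(\<psi> u, \<psi> y) \<in> ?F ^^ k" if "(u, y) \<in> (?E' - {(u, v), (v, u)}) ^^ k" for k y
      using that
    proof (induction k arbitrary: y)
      case (Suc k)
      then obtain z where z: "(u, z) \<in> (?E' - {(u, v), (v, u)}) ^^ k" "(z, y) \<in> ?E' - {(u, v), (v, u)}"
        by auto
      have "(\<psi> z, \<psi> y) \<in> ?F"
        using z(2) uv(1) inj_on_eq_iff[OF assms(2)] by auto
      with Suc.IH[OF z(1)] show ?case by (rule relpow_Suc_I)
    qed simp
    from this[OF walk] show False
      using assms(1) uv unfolding girth_at_least_def apart_def by blast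
  qed
  then show ?thesis unfolding girth_at_least_def apart_def by blast
qed

lemma no_loops_of_girth: "girth_at_least g E \<Longrightarrow> 2 \<le> g \<Longrightarrow> (u, u) \<notin> E"
  unfolding girth_at_least_def apart_def by (auto dest!: bspec spec[of _ 0])

text \<open>
The graph on \<open>{0..<m}\<close> is the pullback of the graph of \<open>regular_graph_with_waves\<close> along an enumeration
of its vertices. The waves are supported on the nodes alone, so the normalized vectors have the
whole of their mass on \<open>2 * (N * L)\<close> coordinates, whatever \<open>\<epsilon>\<close> is.
\<close>

lemma localized_graph_exists:
  assumes d: "2 \<le> d" and gr: "growth_rate d \<theta>" and g: "3 \<le> g"
    and N: "2 * (1 + real g * (real d + 1)\<^sup>2 * \<theta> ^ g) < real N"
    and p: "2 * (1 + real g * (real d + 1) * real d ^ g) < real p"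
    and pq: "(d - 1) * (N * (\<Sum>i<L. link_count d L i)) + (d + 1) * p = (d + 1) * q"
    and m: "m = 2 * (N * L) + N * (\<Sum>i<L. link_count d L i) + p + q" and \<epsilon>: "\<epsilon> \<le> 1"
  obtains G :: "nat pair_pre_digraph" where "pair_graph G" "pverts G = {0..<m}" "regular (d + 1) G"
    "enat g \<le> girth G"
    "\<And>j. j \<in> {1..L} \<Longrightarrow> \<exists>v. normalized_eigenvector (adjacency_mat G) v (2 * cos (pi * real j / (real L + 1)))
      \<and> localized (2 * (N * L)) \<epsilon> v"
proof -
  let ?V = "vertices d L N p q"
  obtain E where E: "sym E" "girth_at_least g E" "E \<subseteq> ?V \<times> ?V"
    "\<And>v. v \<in> ?V \<Longrightarrow> card (E `` {v}) = d + 1"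
    "\<And>t v. sin (t * (real L + 1)) = 0 \<Longrightarrow> v \<in> ?V \<Longrightarrow> (\<Sum>w\<in>E `` {v}. wave t w) = 2 * cos t * wave t v"
    using regular_graph_with_waves[OF d gr g N p pq] by metis
  have finV: "finite ?V" unfolding vertices_def by simp
  have "card ?V = m" unfolding card_vertices m ..
  then obtain \<psi> where \<psi>: "bij_betw \<psi> {0..<m} ?V" using ex_bij_betw_nat_finite[OF finV] by blast
  then have inj: "inj_on \<psi> {0..<m}" and img: "\<psi> ` {0..<m} = ?V" unfolding bij_betw_def by auto
  define E' where "E' = {(x, y). x \<in> {0..<m} \<and> y \<in> {0..<m} \<and> (\<psi> x, \<psi> y) \<in> E}"
  define G where "G = \<lparr>pverts = {0..<m}, parcs = E'\<rparr>"
  have sym': "sym E'" using E(1) unfolding E'_def sym_def by blast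
  have girth': "girth_at_least g E'" unfolding E'_def by (rule girth_at_least_pullback[OF E(2) inj])
  have loop': "(x, x) \<notin> E'" for x using no_loops_of_girth[OF girth'] g by simp
  have sub': "E' \<subseteq> {0..<m} \<times> {0..<m}" unfolding E'_def by blast
  have \<psi>V: "\<psi> x \<in> ?V" if "x < m" for x using img that by (metis atLeastLessThan_iff imageI le0)
  have nbrs': "bij_betw \<psi> (E' `` {x}) (E `` {\<psi> x})" if x: "x < m" for x
    unfolding bij_betw_def
  proof
    show "inj_on \<psi> (E' `` {x})" using inj by (rule inj_on_subset) (use sub' in auto)
    show "\<psi> ` (E' `` {x}) = E `` {\<psi> x}"
    proof
      show "E `` {\<psi> x} \<subseteq> \<psi> ` (E' `` {x})"
      proof
        fix w assume w: "w \<in> E `` {\<psi> x}"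
        then have "w \<in> \<psi> ` {0..<m}" using E(3) img by auto
        then obtain y where "y \<in> {0..<m}" "w = \<psi> y" by blast
        then show "w \<in> \<psi> ` (E' `` {x})" using w x unfolding E'_def by auto
      qed
    qed (auto simp: E'_def)
  qed
  have pg: "pair_graph G"
  proof unfold_locales
    show "finite (parcs G)" unfolding G_def using sub' finite_subset by fastforce
    show "symmetric (with_proj G)" using sym' unfolding symmetric_def G_def by simp
  qed (use sub' loop' in \<open>auto simp: G_def\<close>)
  have reg: "regular (d + 1) G"
    unfolding regular_def
  proof
    fix x assume "x \<in> pverts G"
    then have x: "x < m" unfolding G_def by simp
    have "out_arcs (with_proj G) x = Pair x ` (E' `` {x})"
      unfolding out_arcs_def G_def by auto
    then have "out_degree (with_proj G) x = card (E' `` {x})"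
      unfolding out_degree_def by (simp add: card_image inj_on_def)
    also have "\<dots> = card (E `` {\<psi> x})" using bij_betw_same_card[OF nbrs'[OF x]] .
    also have "\<dots> = d + 1" using E(4)[OF \<psi>V[OF x]] .
    finally show "out_degree (with_proj G) x = d + 1" .
  qed
  have girthG: "enat g \<le> girth G"
    by (rule girth_ge) (simp_all add: G_def sym' girth')
  have eig: "\<exists>v. normalized_eigenvector (adjacency_mat G) v (2 * cos (pi * real j / (real L + 1)))
      \<and> localized (2 * (N * L)) \<epsilon> v" if j: "j \<in> {1..L}" for j
  proof -
    define t where "t = pi * real j / (real L + 1)"
    define f where "f x = wave t (\<psi> x)" for x
    define Q where "Q = (\<Sum>x<m. (f x)\<^sup>2)"
    have "pi * real j < pi * (real L + 1)" using j by (intro mult_strict_left_mono) auto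
    then have t0: "0 < t" "t < pi" using j by (auto simp: t_def field_simps)
    have "t * (real L + 1) = real j * pi" unfolding t_def by (simp add: field_simps)
    then have sin0: "sin (t * (real L + 1)) = 0" by simp
    have eq: "(\<Sum>y\<in>E' `` {x}. f y) = 2 * cos t * f x" if x: "x < m" for x
    proof -
      have "(\<Sum>y\<in>E' `` {x}. f y) = (\<Sum>w\<in>E `` {\<psi> x}. wave t w)"
        unfolding f_def by (rule sum.reindex_bij_betw[OF nbrs'[OF x]])
      also have "\<dots> = 2 * cos t * f x" unfolding f_def using E(5)[OF sin0 \<psi>V[OF x]] .
      finally show ?thesis .
    qed
    have Qpos: "0 < Q"
    proof -
      have "0 < real N"
      proof -
        have "0 \<le> real g * (real d + 1)\<^sup>2 * \<theta> ^ g" using growth_rate_bounds(6)[OF gr d] by simp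
        then have "0 < 2 * (1 + real g * (real d + 1)\<^sup>2 * \<theta> ^ g)" by simp
        also note N
        finally show ?thesis .
      qed
      then have "Node True 0 0 \<in> ?V" using j unfolding vertices_def by auto
      then obtain x where x: "x \<in> {0..<m}" "\<psi> x = Node True 0 0" using img by (metis imageE)
      then have "0 < (f x)\<^sup>2" using sin_gt_zero[OF t0] unfolding f_def by simp
      also have "(f x)\<^sup>2 \<le> Q" unfolding Q_def using x by (intro member_le_sum) auto
      finally show ?thesis .
    qed
    define v where "v = vec m (\<lambda>x. f x / sqrt Q)"
    have v_carrier: "v \<in> carrier_vec m" unfolding v_def by simp
    have v_sq: "(v $ x)\<^sup>2 = (f x)\<^sup>2 / Q" if "x < m" for x
      using that Qpos unfolding v_def by (simp add: power_divide)
    have sum_sq: "(\<Sum>x<m. (v $ x)\<^sup>2) = 1"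
    proof -
      have "(\<Sum>x<m. (v $ x)\<^sup>2) = (\<Sum>x<m. (f x)\<^sup>2 / Q)" using v_sq by (intro sum.cong) auto
      also have "\<dots> = 1" using Qpos unfolding Q_def by (simp flip: sum_divide_distrib)
      finally show ?thesis .
    qed
    have norm: "v \<bullet> v = 1"
      using sum_sq unfolding scalar_prod_def v_def by (simp add: power2_eq_square lessThan_atLeast0)
    have dimA: "adjacency_mat G \<in> carrier_mat m m" unfolding adjacency_mat_def G_def by simp
    have "adjacency_mat G *\<^sub>v v = (2 * cos t) \<cdot>\<^sub>v v"
    proof (rule eq_vecI)
      fix x assume "x < dim_vec ((2 * cos t) \<cdot>\<^sub>v v)"
      then have x: "x < m" unfolding v_def by simp
      have "(adjacency_mat G *\<^sub>v v) $ x = (\<Sum>y<m. (if (x, y) \<in> E' then 1 else 0) * (f y / sqrt Q))"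
        using x unfolding adjacency_mat_def G_def v_def by (simp add: scalar_prod_def lessThan_atLeast0)
      also have "\<dots> = (\<Sum>y\<in>{y\<in>{..<m}. (x, y) \<in> E'}. f y / sqrt Q)"
        by (subst sum.inter_filter) (auto intro: sum.cong)
      also have "{y\<in>{..<m}. (x, y) \<in> E'} = E' `` {x}" using sub' by auto
      also have "(\<Sum>y\<in>E' `` {x}. f y / sqrt Q) = 2 * cos t * f x / sqrt Q"
        using eq[OF x] by (simp flip: sum_divide_distrib)
      finally show "(adjacency_mat G *\<^sub>v v) $ x = ((2 * cos t) \<cdot>\<^sub>v v) $ x" using x unfolding v_def by simp
    qed (simp add: adjacency_mat_def G_def v_def)
    moreover have "v \<noteq> 0\<^sub>v m" using norm v_carrier by auto
    ultimately have ev: "normalized_eigenvector (adjacency_mat G) v (2 * cos t)"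
      using norm v_carrier dimA unfolding normalized_eigenvector_def eigenvector_def by auto
    let ?S = "{x\<in>{0..<m}. \<psi> x \<in> nodes True L N \<union> nodes False L N}"
    have "card ?S = card (nodes True L N \<union> nodes False L N)"
    proof (rule bij_betw_same_card[of \<psi>], unfold bij_betw_def, intro conjI)
      show "inj_on \<psi> ?S" using inj by (rule inj_on_subset) auto
      have "nodes True L N \<union> nodes False L N \<subseteq> \<psi> ` {0..<m}" unfolding img vertices_def by blast
      then show "\<psi> ` ?S = nodes True L N \<union> nodes False L N" by blast
    qed
    also have "\<dots> = 2 * (N * L)"
      by (subst card_Un_disjoint) (auto simp: card_nodes)
    finally have cardS: "card ?S = 2 * (N * L)" .
    have "(\<Sum>x\<in>?S. (v $ x)\<^sup>2) = (\<Sum>x<m. (v $ x)\<^sup>2)"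
    proof (rule sum.mono_neutral_left)
      show "\<forall>x\<in>{..<m} - ?S. (v $ x)\<^sup>2 = 0"
      proof
        fix x assume x: "x \<in> {..<m} - ?S"
        then have "\<psi> x \<notin> nodes True L N" "\<psi> x \<notin> nodes False L N" "\<psi> x \<in> ?V" using \<psi>V by auto
        then have "wave t (\<psi> x) = 0" unfolding vertices_def by auto
        then show "(v $ x)\<^sup>2 = 0" using x v_sq unfolding f_def by simp
      qed
    qed auto
    then have "localized (2 * (N * L)) \<epsilon> v"
      unfolding localized_def using cardS sum_sq \<epsilon> v_carrier
      by (intro exI[of _ ?S]) auto
    then show ?thesis using ev unfolding t_def by blast
  qed
  show ?thesis by (rule that[OF pg _ reg girthG eig]) (simp_all add: G_def)
qed

section \<open>Choice of the parameters\<close>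

text \<open>
At \<open>\<theta>\<^sup>2 = 2 * d - 1\<close> the last inequality of \<open>growth_rate\<close> is strict: it reads
\<open>3 * d - 1 < \<theta> * (d + 1)\<close>, and the difference of the squares is \<open>2 * (d - 1) ^ 3\<close>. By continuity
it persists for some smaller \<open>\<theta>\<close>.
\<close>

lemma growth_rate_exists:
  assumes "2 \<le> d" obtains \<theta> where "growth_rate d \<theta>"
proof -
  define D where "D = real d"
  have D: "2 \<le> D" using assms unfolding D_def by simp
  define h where "h \<theta> = (\<theta> - 1) * (\<theta>\<^sup>2 - D + 2)" for \<theta> :: real
  define r where "r = sqrt (2 * D - 1)"
  have r2: "r\<^sup>2 = 2 * D - 1" and r1: "1 < r" using D unfolding r_def by (auto simp: real_less_rsqrt)
  have "3 * D - 1 < r * (D + 1)"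
  proof (rule power_less_imp_less_base[of _ 2])
    have "0 < (D - 1) ^ 3" using D by simp
    then show "(3 * D - 1)\<^sup>2 < (r * (D + 1))\<^sup>2"
      unfolding power_mult_distrib r2 by (simp add: power2_eq_square power3_eq_cube algebra_simps)
    show "0 \<le> r * (D + 1)" using r1 D by simp
  qed
  then have hr: "2 * (D - 1) < h r" unfolding h_def r2 by (simp add: algebra_simps)
  have lim: "(h \<longlongrightarrow> h r) (at_left r)" "((\<lambda>\<theta>. \<theta>\<^sup>2) \<longlongrightarrow> r\<^sup>2) (at_left r)"
    unfolding h_def by (auto intro!: tendsto_eq_intros)
  have "\<forall>\<^sub>F \<theta> in at_left r. 2 * (D - 1) < h \<theta>" using order_tendstoD(1)[OF lim(1) hr] .
  moreover have "\<forall>\<^sub>F \<theta> in at_left r. D < \<theta>\<^sup>2" using order_tendstoD(1)[OF lim(2), of D] r2 D by simp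
  moreover have "\<forall>\<^sub>F \<theta> in at_left r. \<theta> \<in> {1<..<r}" using r1 by (rule eventually_at_left_real)
  ultimately have "\<forall>\<^sub>F \<theta> in at_left r. 2 * (D - 1) < h \<theta> \<and> D < \<theta>\<^sup>2 \<and> \<theta> \<in> {1<..<r}"
    by eventually_elim auto
  then obtain \<theta> where \<theta>: "2 * (D - 1) < h \<theta>" "D < \<theta>\<^sup>2" "1 < \<theta>" "\<theta> < r"
    using eventually_happens[of _ "at_left r"] by (auto simp: trivial_limit_at_left_real)
  have "\<theta>\<^sup>2 < r\<^sup>2" using \<theta> by (intro power_strict_mono) auto
  then have "growth_rate d \<theta>" using \<theta> r2 unfolding growth_rate_def h_def D_def by simp
  then show ?thesis by (rule that)
qed

text \<open>
The three comparisons that make a large \<open>L\<close> work: the support is at most \<open>D ^ L\<close>, there are more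
fillers than two balls contain, and the number of vertices stays in its window. In each of them an exponential
with larger base or exponent wins.
\<close>

lemma eventually_parameter_bounds:
  fixes D x K :: real
  assumes "2 \<le> D" "1 < x" "x < D" "0 < K"
  shows "\<forall>\<^sub>F L in sequentially. (D + 1) * real L * (4 + K * (2 * real L + 6) * x ^ L) \<le> D ^ L"
    "\<forall>\<^sub>F L in sequentially. 2 * (1 + (2 * real L + 6) * (D + 1) * D ^ (2 * L + 6)) < D ^ (6 * L)"
    "\<forall>\<^sub>F L in sequentially. 2 + (2 * D + 4) * D ^ L < 62 * D ^ (6 * L)"
proof -
  show "\<forall>\<^sub>F L in sequentially. (D + 1) * real L * (4 + K * (2 * real L + 6) * x ^ L) \<le> D ^ L"
    using assms by real_asymp
  show "\<forall>\<^sub>F L in sequentially. 2 * (1 + (2 * real L + 6) * (D + 1) * D ^ (2 * L + 6)) < D ^ (6 * L)"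
    using assms by real_asymp
  show "\<forall>\<^sub>F L in sequentially. 2 + (2 * D + 4) * D ^ L < 62 * D ^ (6 * L)"
    using assms by real_asymp
qed

text \<open>
Given \<open>L\<close>, put \<open>m\<close> into the window from \<open>d powr (L / \<alpha>)\<close> to \<open>d powr ((L + 1) / \<alpha>)\<close>. Then \<open>L\<close> is
at least the number of eigenvalues asked for, and \<open>d ^ L\<close> at most \<open>m powr \<alpha>\<close>. The girth asked for is
at most \<open>2 * (L + 1) * \<rho>\<close> with \<open>\<rho> = ln d / ln (2 * d - 1)\<close>. As \<open>\<theta>\<^sup>2 < 2 * d - 1\<close>, the ball size
\<open>\<theta> ^ g\<close> is up to constants \<open>x ^ L\<close> with \<open>x = \<theta> powr (2 * \<rho>) < d\<close>, so that \<open>N * L\<close>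
stays below \<open>d ^ L\<close>. The fillers only have to exceed \<open>d ^ g\<close>, which is at most \<open>d ^ (2 * L + 6)\<close>, and there are
about \<open>d powr (L / \<alpha>)\<close> of them, at least \<open>d ^ (6 * L)\<close>.
\<close>

lemma parameters_exist:
  fixes \<alpha> \<theta> :: real
  assumes d: "2 \<le> d" and \<alpha>: "0 < \<alpha>" "\<alpha> < 1 / 6" and gr: "growth_rate d \<theta>"
  obtains L g N p q m where
    "3 \<le> g" "2 * (1 + real g * (real d + 1)\<^sup>2 * \<theta> ^ g) < real N"
    "2 * (1 + real g * (real d + 1) * real d ^ g) < real p"
    "(d - 1) * (N * (\<Sum>i<L. link_count d L i)) + (d + 1) * p = (d + 1) * q"
    "m = 2 * (N * L) + N * (\<Sum>i<L. link_count d L i) + p + q"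
    "B < m" "real (2 * (N * L)) \<le> 2 * real m powr \<alpha>"
    "nat \<lfloor>\<alpha> * log (real d) (real m)\<rfloor> \<le> L"
    "2 * \<alpha> * log (2 * real d - 1) (real m) \<le> real g"
proof -
  define D where "D = real d"
  define b where "b = 2 * D - 1"
  define \<rho> where "\<rho> = ln D / ln b"
  define x where "x = \<theta> powr (2 * \<rho>)"
  define K where "K = 2 * (D + 1)\<^sup>2 * \<theta> ^ 4 * x"
  have D: "2 \<le> D" using d unfolding D_def by simp
  have b: "D < b" using D unfolding b_def by simp
  have lnD: "0 < ln D" and lnb: "0 < ln b" using D b by auto
  have \<rho>: "0 < \<rho>" "\<rho> \<le> 1" using lnD lnb D b unfolding \<rho>_def by auto
  have \<theta>: "1 < \<theta>" "\<theta>\<^sup>2 < b" using gr unfolding growth_rate_def b_def D_def by auto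
  have x1: "1 < x" using \<theta>(1) \<rho> unfolding x_def by simp
  have xD: "x < D"
  proof -
    have "2 * ln \<theta> = ln (\<theta>\<^sup>2)" using \<theta> by (simp add: ln_realpow)
    also have "\<dots> < ln b" using \<theta> D b by (subst ln_less_cancel_iff) auto
    finally have "ln x < \<rho> * ln b" using \<theta>(1) \<rho> unfolding x_def by (simp add: ln_powr)
    also have "\<dots> = ln D" using lnb unfolding \<rho>_def by simp
    finally show ?thesis using x1 D by simp
  qed
  have K: "0 < K" using D \<theta> x1 unfolding K_def by simp
  obtain L where L: "(D + 1) * real L * (4 + K * (2 * real L + 6) * x ^ L) \<le> D ^ L"
    "2 * (1 + (2 * real L + 6) * (D + 1) * D ^ (2 * L + 6)) < D ^ (6 * L)"
    "2 + (2 * D + 4) * D ^ L < 62 * D ^ (6 * L)" "B \<le> L"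
    using eventually_happens[OF eventually_conj[OF eventually_conj[OF eventually_parameter_bounds(1,2)[OF D x1 xD K]]
        eventually_conj[OF eventually_parameter_bounds(3)[OF D x1 xD K] eventually_ge_at_top[of B]]]] by auto
  \<comment> \<open>The summand 3 only serves to make g at least 3.\<close>
  define g where "g = nat \<lceil>2 * (real L + 1) * \<rho>\<rceil> + 3"
  define N' where "N' = nat \<lceil>2 * (1 + real g * (D + 1)\<^sup>2 * \<theta> ^ g)\<rceil> + 1"
  \<comment> \<open>The factor d + 1 makes the demand of the links divisible by d + 1, so that q can balance it.\<close>
  define N where "N = (d + 1) * N'"
  define T where "T = D powr (real L / \<alpha>)"
  define p where "p = nat \<lceil>T\<rceil>"
  define U where "U = (\<Sum>i<L. link_count d L i)"
  define q where "q = p + (d - 1) * N' * U"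
  define m where "m = 2 * (N * L) + N * U + p + q"

  have "0 \<le> 2 * (real L + 1) * \<rho>" using \<rho> by simp
  then have g_bounds: "2 * (real L + 1) * \<rho> \<le> real g" "real g \<le> 2 * (real L + 1) * \<rho> + 4"
    unfolding g_def by linarith+
  have "2 * (real L + 1) * \<rho> \<le> 2 * (real L + 1) * 1" using \<rho> by (intro mult_left_mono) auto
  from order_trans[OF g_bounds(2) add_right_mono[OF this]] have gL: "real g \<le> 2 * real L + 6" by simp
  have \<theta>g: "\<theta> ^ g \<le> \<theta> ^ 4 * x * x ^ L"
  proof -
    have "\<theta> ^ g = \<theta> powr real g" using \<theta> by (simp add: powr_realpow)
    also have "\<dots> \<le> \<theta> powr (2 * \<rho> * real (Suc L) + real 4)"
      using g_bounds(2) \<theta> by (intro powr_mono) (auto simp: algebra_simps)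
    also have "\<dots> = x powr real (Suc L) * \<theta> powr real 4" unfolding powr_add x_def powr_powr ..
    also have "\<dots> = x ^ Suc L * \<theta> ^ 4" using x1 \<theta> by (subst (1 2) powr_realpow) auto
    finally show ?thesis by (simp add: mult_ac)
  qed
  define z where "z = 2 * (1 + real g * (D + 1)\<^sup>2 * \<theta> ^ g)"
  have "0 \<le> real g * (D + 1)\<^sup>2 * \<theta> ^ g" using \<theta> by simp
  then have "0 \<le> z" unfolding z_def by simp
  then have N': "z < real N'" "real N' \<le> z + 2"
    unfolding N'_def z_def[symmetric] by linarith+
  have "real N' \<le> real N" unfolding N_def by simp
  then have Nbig: "z < real N" using N'(1) by linarith
  have NL: "real (N * L) \<le> D ^ L"
  proof -
    have "real g * ((D + 1)\<^sup>2 * \<theta> ^ g) \<le> (2 * real L + 6) * ((D + 1)\<^sup>2 * (\<theta> ^ 4 * x * x ^ L))"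
      using gL \<theta>g \<theta> by (intro mult_mono) auto
    then have "2 * (real g * (D + 1)\<^sup>2 * \<theta> ^ g) \<le> K * (2 * real L + 6) * x ^ L"
      unfolding K_def by (simp add: mult_ac)
    then have "real N' \<le> 4 + K * (2 * real L + 6) * x ^ L" using N'(2) unfolding z_def by simp
    then have "(D + 1) * real L * real N' \<le> (D + 1) * real L * (4 + K * (2 * real L + 6) * x ^ L)"
      using D by (intro mult_left_mono) auto
    moreover have "real (N * L) = (D + 1) * real L * real N'" unfolding N_def D_def by (simp add: algebra_simps)
    ultimately show ?thesis using L(1) by linarith
  qed

  have TL: "D ^ (6 * L) \<le> T"
  proof -
    have "real L * 6 \<le> real L * (1 / \<alpha>)" using \<alpha> by (intro mult_left_mono) (auto simp: field_simps)
    then have "real (6 * L) \<le> real L / \<alpha>" by simp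
    then have "D powr real (6 * L) \<le> T" unfolding T_def using D by (intro powr_mono) auto
    then show ?thesis using D by (subst (asm) powr_realpow) auto
  qed
  have T0: "0 < T" using D unfolding T_def by simp
  have p: "T \<le> real p" "real p \<le> T + 1" unfolding p_def using T0 by linarith+
  have pbig: "2 * (1 + real g * (D + 1) * D ^ g) < real p"
  proof -
    have "g \<le> 2 * L + 6" using gL by linarith
    then have "real g * (D + 1) * D ^ g \<le> (2 * real L + 6) * (D + 1) * D ^ (2 * L + 6)"
      using gL D by (intro mult_mono power_increasing) auto
    then have "2 * (1 + real g * (D + 1) * D ^ g) \<le> 2 * (1 + (2 * real L + 6) * (D + 1) * D ^ (2 * L + 6))"
      by simp
    also note L(2)
    also note TL
    also note p(1)
    finally show ?thesis .
  qed
  have "U \<le> (\<Sum>i<L. d + 1)" unfolding U_def by (intro sum_mono) (simp add: link_count_def)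
  also have "\<dots> = L * (d + 1)" by simp
  finally have "N * U \<le> N * (L * (d + 1))" by (rule mult_le_mono2)
  then have NU: "N * U \<le> (d + 1) * (N * L)" by (simp only: mult_ac)
  have "(d - 1) * N' * U \<le> N * U" unfolding N_def by (intro mult_le_mono) auto
  then have "m \<le> 2 * p + (2 * d + 4) * (N * L)" unfolding m_def q_def using NU by (simp add: algebra_simps)
  then have "real m \<le> real (2 * p + (2 * d + 4) * (N * L))" by (rule of_nat_mono)
  also have "\<dots> = 2 * real p + (2 * D + 4) * real (N * L)" unfolding D_def by simp
  also have "\<dots> \<le> 2 * (T + 1) + (2 * D + 4) * D ^ L"
    using p(2) NL D by (intro add_mono mult_left_mono) auto
  also have "\<dots> < 64 * T" using L(3) TL by simp
  also have "\<dots> \<le> D powr (1 / \<alpha>) * T"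
  proof -
    have "(2::real) ^ 6 \<le> D ^ 6" using D by (intro power_mono) auto
    also have "\<dots> = D powr 6" using D by (simp add: powr_realpow flip: powr_numeral)
    also have "\<dots> \<le> D powr (1 / \<alpha>)" using D \<alpha> by (intro powr_mono) (auto simp: field_simps)
    finally show ?thesis using T0 by (intro mult_right_mono) auto
  qed
  also have "\<dots> = D powr ((real L + 1) / \<alpha>)" unfolding T_def by (simp add: add_divide_distrib add.commute flip: powr_add)
  finally have m_up: "real m < D powr ((real L + 1) / \<alpha>)" .
  have "p \<le> m" unfolding m_def by simp
  then have m_low: "T \<le> real m" using p(1) by linarith
  then have m0: "0 < real m" using T0 by linarith
  have "ln (real m) < ln (D powr ((real L + 1) / \<alpha>))" using m_up m0 by (subst ln_less_cancel_iff) auto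
  then have ln_m: "\<alpha> * ln (real m) < (real L + 1) * ln D"
    using \<alpha> D by (simp add: ln_powr field_simps)

  show ?thesis
  proof (rule that[of g N p L q m])
    show "3 \<le> g" unfolding g_def by simp
    show "2 * (1 + real g * (real d + 1)\<^sup>2 * \<theta> ^ g) < real N" using Nbig unfolding z_def D_def .
    show "2 * (1 + real g * (real d + 1) * real d ^ g) < real p" using pbig unfolding D_def .
    show "(d - 1) * (N * (\<Sum>i<L. link_count d L i)) + (d + 1) * p = (d + 1) * q"
      unfolding U_def[symmetric] q_def N_def by (simp only: distrib_left mult_ac add_ac)
    show "m = 2 * (N * L) + N * (\<Sum>i<L. link_count d L i) + p + q" unfolding m_def U_def ..
    have "real B < D ^ (6 * L)"
    proof -
      have "real B \<le> real (6 * L)" using L(4) by simp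
      also have "\<dots> < 2 ^ (6 * L)" by (rule of_nat_less_two_power)
      also have "\<dots> \<le> D ^ (6 * L)" using D by (intro power_mono) auto
      finally show ?thesis .
    qed
    then show "B < m" using TL m_low by linarith
    have "D ^ L = T powr \<alpha>" unfolding T_def powr_powr using \<alpha> D by (simp add: powr_realpow)
    also have "\<dots> \<le> real m powr \<alpha>" using m_low T0 \<alpha> by (intro powr_mono2) auto
    finally show "real (2 * (N * L)) \<le> 2 * real m powr \<alpha>" using NL by simp
    have "\<alpha> * log D (real m) < real L + 1" unfolding log_def using ln_m lnD by (simp add: field_simps)
    then show "nat \<lfloor>\<alpha> * log (real d) (real m)\<rfloor> \<le> L" unfolding D_def by linarith
    have "2 * \<alpha> * log b (real m) = 2 * (\<alpha> * ln (real m)) / ln b" unfolding log_def by simp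
    also have "\<dots> \<le> 2 * ((real L + 1) * ln D) / ln b"
      using ln_m lnb by (intro divide_right_mono) auto
    also have "\<dots> = 2 * (real L + 1) * \<rho>" unfolding \<rho>_def by simp
    finally show "2 * \<alpha> * log (2 * real d - 1) (real m) \<le> real g"
      using g_bounds(1) unfolding b_def D_def by linarith
  qed
qed

lemma log_comparison:
  assumes "2 \<le> d" "0 \<le> \<alpha>" "1 \<le> m"
  shows "2 * \<alpha> * log (real d) (real m) * (1 - ln 2 / ln (2 * real d - 1))
    \<le> 2 * \<alpha> * log (2 * real d - 1) (real m)"
proof -
  define b where "b = 2 * real d - 1"
  have b: "0 < ln b" "0 < ln (real d)" using assms unfolding b_def by auto
  have "ln b \<le> ln (2 * real d)" using assms unfolding b_def by (subst ln_le_cancel_iff) auto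
  also have "\<dots> = ln 2 + ln (real d)" using assms by (simp add: ln_mult)
  finally have "(ln b - ln 2) / ln (real d) \<le> 1" using b by simp
  moreover have "0 \<le> 2 * \<alpha> * ln (real m) / ln b" using assms b by simp
  ultimately have "2 * \<alpha> * ln (real m) / ln b * ((ln b - ln 2) / ln (real d)) \<le> 2 * \<alpha> * ln (real m) / ln b * 1"
    by (intro mult_left_mono)
  then show ?thesis unfolding log_def b_def[symmetric] using b by (simp add: field_simps)
qed

text \<open>
Since the construction yields graphs with arbitrarily many vertices, the orders that occur
form an infinite set, and for each of them one graph is chosen. The eigenvalues \<open>2 * cos (pi * j / (L + 1))\<close>
are distinct because the cosine is injective on \<open>{0..pi}\<close>.
\<close>

lemma high_girth_localized_below_sixth:
  assumes d: "2 \<le> d" and \<alpha>: "0 < \<alpha>" "\<alpha> < 1 / 6" and \<epsilon>: "\<epsilon> \<le> 1"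
  shows "high_girth_localized d \<alpha> \<epsilon>"
proof -
  obtain \<theta> where gr: "growth_rate d \<theta>" using growth_rate_exists[OF d] .
  define good where "good m L k G \<longleftrightarrow>
      0 < m \<and> pair_graph G \<and> pverts G = {0..<m} \<and> regular (d + 1) G \<and>
      ereal (2 * \<alpha> * log (2 * real d - 1) (real m)) \<le> ereal_of_enat (girth G) \<and>
      real k \<le> 2 * real m powr \<alpha> \<and> nat \<lfloor>\<alpha> * log (real d) (real m)\<rfloor> \<le> L \<and>
      (\<forall>j\<in>{1..L}. \<exists>v. normalized_eigenvector (adjacency_mat G) v (2 * cos (pi * real j / (real L + 1)))
        \<and> localized k \<epsilon> v)" for m L k :: nat and G :: "nat pair_pre_digraph"
  have ex: "\<exists>m>B. \<exists>L k G. good m L k G" for B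
  proof -
    obtain L g N p q m where s: "3 \<le> g" "2 * (1 + real g * (real d + 1)\<^sup>2 * \<theta> ^ g) < real N"
      "2 * (1 + real g * (real d + 1) * real d ^ g) < real p"
      "(d - 1) * (N * (\<Sum>i<L. link_count d L i)) + (d + 1) * p = (d + 1) * q"
      "m = 2 * (N * L) + N * (\<Sum>i<L. link_count d L i) + p + q"
      "B < m" "real (2 * (N * L)) \<le> 2 * real m powr \<alpha>"
      "nat \<lfloor>\<alpha> * log (real d) (real m)\<rfloor> \<le> L"
      "2 * \<alpha> * log (2 * real d - 1) (real m) \<le> real g"
      using parameters_exist[OF d \<alpha> gr] by metis
    obtain G :: "nat pair_pre_digraph" where G: "pair_graph G" "pverts G = {0..<m}" "regular (d + 1) G"
      "enat g \<le> girth G"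
      "\<And>j. j \<in> {1..L} \<Longrightarrow> \<exists>v. normalized_eigenvector (adjacency_mat G) v (2 * cos (pi * real j / (real L + 1)))
        \<and> localized (2 * (N * L)) \<epsilon> v"
      using localized_graph_exists[OF d gr s(1-5) \<epsilon>] by metis
    have "ereal (2 * \<alpha> * log (2 * real d - 1) (real m)) \<le> ereal_of_enat (enat g)"
      using s(9) by simp
    also have "\<dots> \<le> ereal_of_enat (girth G)" using G(4) by (simp only: ereal_of_enat_le_iff)
    finally have "good m L (2 * (N * L)) G" using G s(6-8) unfolding good_def by auto
    then show ?thesis using s(6) by blast
  qed
  define M where "M = {m. \<exists>L k G. good m L k G}"
  have "infinite M" unfolding infinite_nat_iff_unbounded M_def using ex by blast
  have "\<forall>m. \<exists>L k G. m \<in> M \<longrightarrow> good m L k G" unfolding M_def by blast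
  then obtain L k G where LkG: "\<And>m. m \<in> M \<Longrightarrow> good m (L m) (k m) (G m)" by metis
  define \<mu> where "\<mu> m j = 2 * cos (pi * real j / (real (L m) + 1))" for m j
  have "(\<lambda>m. real (k m)) \<in> O[inf at_top (principal M)](\<lambda>m. real m powr \<alpha>)"
    using LkG unfolding good_def
    by (intro bigoI[where c = 2]) (auto simp: eventually_inf_principal intro!: always_eventually)
  moreover have "inj_on (\<mu> m) {1..nat \<lfloor>\<alpha> * log (real d) (real m)\<rfloor>}" if "m \<in> M" for m
  proof (rule inj_onI)
    fix i j assume "i \<in> {1..nat \<lfloor>\<alpha> * log (real d) (real m)\<rfloor>}" "j \<in> {1..nat \<lfloor>\<alpha> * log (real d) (real m)\<rfloor>}"
      and eq: "\<mu> m i = \<mu> m j"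
    then have ij: "i \<le> L m" "j \<le> L m" using LkG[OF that] unfolding good_def by auto
    have range: "0 \<le> pi * real i / (real (L m) + 1)" "pi * real i / (real (L m) + 1) \<le> pi" if "i \<le> L m" for i
      using that mult_left_mono[of "real i" "real (L m) + 1" pi] by (auto simp: divide_le_eq)
    have "pi * real i / (real (L m) + 1) = pi * real j / (real (L m) + 1)"
      using eq cos_inj_pi[OF range[OF ij(1)] range[OF ij(2)]] unfolding \<mu>_def by simp
    then show "i = j" by (simp add: divide_eq_eq)
  qed
  moreover have "2 * \<alpha> * log (2 * real d - 1) (real m)
      \<ge> 2 * \<alpha> * log (real d) (real m) * (1 - ln 2 / ln (2 * real d - 1))" if "m \<in> M" for m
    using log_comparison[OF d, of \<alpha> m] \<alpha> LkG[OF that] unfolding good_def by simp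
  moreover have "\<exists>v. normalized_eigenvector (adjacency_mat (G m)) v (\<mu> m i) \<and> localized (k m) \<epsilon> v"
    if "m \<in> M" "i \<in> {1..nat \<lfloor>\<alpha> * log (real d) (real m)\<rfloor>}" for m i
  proof -
    have "i \<in> {1..L m}" using LkG[OF that(1)] that(2) unfolding good_def by auto
    then show ?thesis using LkG[OF that(1)] unfolding good_def \<mu>_def by blast
  qed
  moreover have "0 < m" "pair_graph (G m)" "pverts (G m) = {0..<m}" "regular (d + 1) (G m)"
    "ereal (2 * \<alpha> * log (2 * real d - 1) (real m)) \<le> ereal_of_enat (girth (G m))" if "m \<in> M" for m
    using LkG[OF that] unfolding good_def by blast+
  ultimately show ?thesis
    unfolding high_girth_localized_def using \<open>infinite M\<close>
    by (intro exI[of _ M] exI[of _ G] exI[of _ k] exI[of _ \<mu>] conjI ballI)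
qed

section \<open>The tenth and the eleventh prime\<close>

lemma nth_prime_prime: "prime (nth_prime j)"
  unfolding nth_prime_def using enumerate_in_set[of "{p::nat. prime p}"] primes_infinite by blast

lemma nth_prime_next:
  assumes "nth_prime j = p" "1 \<le> j" "k = Suc j" "p < r" "prime r"
    and gap: "list_all (\<lambda>s. \<not> prime s) [Suc p..<r]"
  shows "nth_prime k = r"
proof -
  have "enumerate {p::nat. prime p} (Suc (j - 1)) = (LEAST s. s \<in> {p. prime p} \<and> enumerate {p. prime p} (j - 1) < s)"
    by (rule enumerate_Suc'') (rule primes_infinite)
  also have "\<dots> = (LEAST s. prime s \<and> p < s)" using assms(1) unfolding nth_prime_def by simp
  also have "\<dots> = r"
  proof (rule Least_equality)
    show "r \<le> s" if "prime s \<and> p < s" for s using gap that by (auto simp: list_all_iff not_less[symmetric])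
  qed (use assms(4,5) in simp)
  finally show ?thesis using assms(2,3) unfolding nth_prime_def by (simp add: Suc_diff_le)
qed

lemma nth_prime_10_11: "nth_prime 10 = 29" "nth_prime 11 = 31"
proof -
  have "nth_prime 1 = (LEAST p. prime p)"
    unfolding nth_prime_def by (simp add: enumerate_0)
  also have "\<dots> = 2" by (intro Least_equality) (auto dest: prime_ge_2_nat)
  finally have 1: "nth_prime 1 = 2" .
  have 2: "nth_prime 2 = 3"
    by (rule nth_prime_next[OF 1]) simp_all
  have 3: "nth_prime 3 = 5"
    by (rule nth_prime_next[OF 2]) simp_all
  have 4: "nth_prime 4 = 7"
    by (rule nth_prime_next[OF 3]) simp_all
  have 5: "nth_prime 5 = 11"
    by (rule nth_prime_next[OF 4]) simp_all
  have 6: "nth_prime 6 = 13"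
    by (rule nth_prime_next[OF 5]) simp_all
  have 7: "nth_prime 7 = 17"
    by (rule nth_prime_next[OF 6]) simp_all
  have 8: "nth_prime 8 = 19"
    by (rule nth_prime_next[OF 7]) simp_all
  have 9: "nth_prime 9 = 23"
    by (rule nth_prime_next[OF 8]) simp_all
  have 10: "nth_prime 10 = 29"
    by (rule nth_prime_next[OF 9]) simp_all
  have 11: "nth_prime 11 = 31"
    by (rule nth_prime_next[OF 10]) simp_all
  show "nth_prime 10 = 29" "nth_prime 11 = 31" by (rule 10, rule 11)
qed

text \<open>
The ratio \<open>ln 29 / ln 31\<close> lies between \<open>39 / 40\<close> and \<open>51 / 52\<close>, by comparing \<open>31 ^ 39\<close> with \<open>29 ^ 40\<close>
and \<open>29 ^ 52\<close> with \<open>31 ^ 51\<close>.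
\<close>

lemma ln_ratio_bounds:
  "ln 29 / (6 * ln 31) < (1 / 6 :: real)" "\<bar>ln 29 / (6 * ln 31) - 0.163\<bar> < (0.0005 :: real)"
proof -
  have pos: "0 < ln (31 :: real)" by simp
  define r :: real where "r = ln 29 / ln 31"
  have "52 * ln 29 = ln ((29 :: real) ^ 52)" by (simp only: ln_realpow)
  also have "\<dots> < ln (31 ^ 51)" by (subst ln_less_cancel_iff) simp_all
  also have "\<dots> = 51 * ln (31 :: real)" by (simp only: ln_realpow)
  finally have up: "r < 51 / 52" using pos unfolding r_def by (simp add: field_simps)
  have "39 * ln (31 :: real) = ln (31 ^ 39)" by (simp only: ln_realpow)
  also have "\<dots> < ln (29 ^ 40)" by (subst ln_less_cancel_iff) simp_all
  also have "\<dots> = 40 * ln (29 :: real)" by (simp only: ln_realpow)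
  finally have low: "39 / 40 < r" using pos unfolding r_def by (simp add: field_simps)
  have eq: "ln 29 / (6 * ln 31) = r / 6" unfolding r_def by simp
  show "ln 29 / (6 * ln 31) < (1 / 6 :: real)" using up unfolding eq by simp
  show "\<bar>ln 29 / (6 * ln 31) - 0.163\<bar> < (0.0005 :: real)"
    using up low unfolding eq abs_less_iff by simp
qed

theorem theorem2:
  shows
    "(\<forall>(j::nat) (d::nat) (\<alpha>::real).
        1 \<le> j \<and> nth_prime j \<le> d \<and> d \<le> nth_prime (j + 1) \<and> 0 < \<alpha> \<and> \<alpha> < 1 / 6 \<and>
        ln (real (nth_prime j)) / ln (real (nth_prime (j + 1))) > 6 * \<alpha> \<longrightarrow>
        (\<forall>\<epsilon>::real. 0 < \<epsilon> \<and> \<epsilon> < 1 \<longrightarrow> high_girth_localized d \<alpha> \<epsilon>)) \<and>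
     nth_prime 10 = 29 \<and> nth_prime 11 = 31 \<and>
     (\<forall>(d::nat) (\<alpha>::real).
        nth_prime 10 \<le> d \<and> 0 < \<alpha> \<and>
        \<alpha> < ln (real (nth_prime 10)) / (6 * ln (real (nth_prime 11))) \<longrightarrow>
        (\<forall>\<epsilon>::real. 0 < \<epsilon> \<and> \<epsilon> < 1 \<longrightarrow> high_girth_localized d \<alpha> \<epsilon>)) \<and>
     \<bar>ln (real (nth_prime 10)) / (6 * ln (real (nth_prime 11))) - 0.163\<bar> < 0.0005"
proof (intro conjI allI impI)
  fix j d :: nat and \<alpha> \<epsilon> :: real
  assume "1 \<le> j \<and> nth_prime j \<le> d \<and> d \<le> nth_prime (j + 1) \<and> 0 < \<alpha> \<and> \<alpha> < 1 / 6 \<and>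
        ln (real (nth_prime j)) / ln (real (nth_prime (j + 1))) > 6 * \<alpha>" "0 < \<epsilon> \<and> \<epsilon> < 1"
  moreover have "2 \<le> nth_prime j" using nth_prime_prime by (rule prime_ge_2_nat)
  ultimately show "high_girth_localized d \<alpha> \<epsilon>" by (intro high_girth_localized_below_sixth) auto
next
  fix d :: nat and \<alpha> \<epsilon> :: real
  assume "nth_prime 10 \<le> d \<and> 0 < \<alpha> \<and> \<alpha> < ln (real (nth_prime 10)) / (6 * ln (real (nth_prime 11)))"
    "0 < \<epsilon> \<and> \<epsilon> < 1"
  moreover from this have "\<alpha> < 1 / 6"
    using ln_ratio_bounds(1) unfolding nth_prime_10_11 of_nat_numeral by (blast intro: less_trans)
  ultimately show "high_girth_localized d \<alpha> \<epsilon>"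
    unfolding nth_prime_10_11 by (intro high_girth_localized_below_sixth) auto
qed (use nth_prime_10_11 ln_ratio_bounds(2) in simp_all)

end
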